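(* Let $2\le q\le\infty$ and let $E$ be a locally convex space with the Rosenthal property. The following are equivalent: (i) every weakly null sequence in $E$ whose range is a $(q,\infty)$-limited set converges to $0$ in $E$; (ii) for every locally convex space $X$ and every continuous linear $T:X\to E$ whose adjoint $T^*:E'_{w^*}\to X'_\beta$ is $q$-convergent, $T$ maps bounded subsets of $X$ to sequentially precompact subsets of $E$; (iii) for every normed space $X$ and every continuous linear $T:X\to E$ with $T^*:E'_{w^*}\to X'_\beta$ $q$-convergent, $T$ is sequentially precompact; (iv) the same as (iii) with $X=\ell_1^0$. If in addition $E$ is locally complete, these are equivalent to: (v) the same as (iii) with $X$ an arbitrary Banach space; (vi) the same as (iii) with $X=\ell_1$.
   Context: For $A\subseteq E$ and $\chi\in E'$, $\|\chi\|_A:=\sup\{|\chi(x)|:x\in A\cup\{0\}\}$. A sequence $(\chi_n)$ in $E'$ is weak$^*$ $q$-summable if $(\chi_n(x))_n\in\ell_q$ for all $x\in E$ ($c_0$ if $q=\infty$). A nonempty $A\subseteq E$ is $(q,\infty)$-limited if $\|\chi_n\|_A\to0$ for every weak$^*$ $q$-summable $(\chi_n)$ in $E'$. $E'_{w^*}$ is $E'$ with $\sigma(E',E)$, $X'_\beta$ is $X'$ with the strong topology. A linear map between lcs is $q$-convergent if it maps weakly $q$-summable sequences (sequences $(y_n)$ with $(\eta(y_n))_n\in\ell_q$, resp. $c_0$ if $q=\infty$, for each continuous functional $\eta$) to null sequences. A set is sequentially precompact if each sequence in it has a Cauchy subsequence; an operator is sequentially precompact if it maps some neighbourhood of zero to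 a sequentially precompact set. $\ell_1^0$ is the span of the unit vectors in $\ell_1$ with the $\ell_1$-norm. $E$ is locally complete if the closed absolutely convex hull of every null sequence is compact. A sequence $(a_n)$ is equivalent to the unit basis of $\ell_1$ if there is a linear topological isomorphism $R$ from the closed span of $\{a_n\}$ onto a subspace of $\ell_1$ with $R(a_n)=e_n$; $E$ has the Rosenthal property if every bounded sequence has a subsequence which is either weakly Cauchy or equivalent to the unit basis of $\ell_1$. *)

theory Defs
  imports "HOL-Analysis.Analysis"
begin

definition l1n :: "(nat \<Rightarrow> real) \<Rightarrow> real" where
  "l1n f = (\<Sum>n. \<bar>f n\<bar>)"

lemma l1_summable_add:
  fixes f g :: "nat \<Rightarrow> real"
  assumes "summable (\<lambda>n. \<bar>f n\<bar>)" "summable (\<lambda>n. \<bar>g n\<bar>)"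
  shows "summable (\<lambda>n. \<bar>f n + g n\<bar>)"
proof (rule summable_comparison_test')
  show "summable (\<lambda>n. \<bar>f n\<bar> + \<bar>g n\<bar>)" using assms by (rule summable_add)
  show "\<And>n. n \<ge> 0 \<Longrightarrow> norm \<bar>f n + g n\<bar> \<le> \<bar>f n\<bar> + \<bar>g n\<bar>" by simp
qed

lemma l1_summable_scale:
  fixes f :: "nat \<Rightarrow> real"
  assumes "summable (\<lambda>n. \<bar>f n\<bar>)"
  shows "summable (\<lambda>n. \<bar>a * f n\<bar>)"
  using summable_mult[OF assms, of "\<bar>a\<bar>"] by (simp add: abs_mult)

lemma l1_summable_uminus:
  fixes f :: "nat \<Rightarrow> real"
  assumes "summable (\<lambda>n. \<bar>f n\<bar>)"
  shows "summable (\<lambda>n. \<bar>- f n\<bar>)"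
  using assms by simp

lemma l1_summable_diff:
  fixes f g :: "nat \<Rightarrow> real"
  assumes "summable (\<lambda>n. \<bar>f n\<bar>)" "summable (\<lambda>n. \<bar>g n\<bar>)"
  shows "summable (\<lambda>n. \<bar>f n - g n\<bar>)"
  using l1_summable_add[OF assms(1) l1_summable_uminus[OF assms(2)]] by simp

lemma l1n_add:
  assumes "summable (\<lambda>n. \<bar>f n\<bar>)" "summable (\<lambda>n. \<bar>g n\<bar>)"
  shows "l1n (\<lambda>n. f n + g n) \<le> l1n f + l1n g"
proof -
  have "(\<Sum>n. \<bar>f n + g n\<bar>) \<le> (\<Sum>n. \<bar>f n\<bar> + \<bar>g n\<bar>)"
    by (rule suminf_le) (auto intro: l1_summable_add[OF assms] summable_add[OF assms])
  also have "\<dots> = (\<Sum>n. \<bar>f n\<bar>) + (\<Sum>n. \<bar>g n\<bar>)" by (rule suminf_add[OF assms, symmetric])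
  finally show ?thesis unfolding l1n_def .
qed

lemma l1n_scale:
  assumes "summable (\<lambda>n. \<bar>f n\<bar>)"
  shows "l1n (\<lambda>n. a * f n) = \<bar>a\<bar> * l1n f"
  unfolding l1n_def using suminf_mult[OF assms, of "\<bar>a\<bar>"] by (simp add: abs_mult)

lemma l1n_eq_0:
  assumes "summable (\<lambda>n. \<bar>f n\<bar>)"
  shows "l1n f = 0 \<longleftrightarrow> f = (\<lambda>n. 0)"
  unfolding l1n_def using suminf_eq_zero_iff[OF assms] by (auto simp: fun_eq_iff)

lemma l1n_nonneg: "summable (\<lambda>n. \<bar>f n\<bar>) \<Longrightarrow> 0 \<le> l1n f"
  unfolding l1n_def by (simp add: suminf_nonneg)

lemma l1_partial_le:
  assumes "summable (\<lambda>n. \<bar>f n\<bar>)"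
  shows "(\<Sum>k<K. \<bar>f k\<bar>) \<le> l1n f"
  unfolding l1n_def by (rule sum_le_suminf[OF assms]) auto

lemma l1_coord_le:
  assumes "summable (\<lambda>n. \<bar>f n\<bar>)"
  shows "\<bar>f k\<bar> \<le> l1n f"
proof -
  have "(\<Sum>j\<in>{k}. \<bar>f j\<bar>) \<le> l1n f"
    unfolding l1n_def by (rule sum_le_suminf[OF assms]) auto
  then show ?thesis by simp
qed

lemma l1_finite_support_summable:
  fixes f :: "nat \<Rightarrow> real"
  assumes "finite {n. f n \<noteq> 0}"
  shows "summable (\<lambda>n. \<bar>f n\<bar>)"
proof -
  have "finite {n. \<bar>f n\<bar> \<noteq> 0}" using assms by simp
  then show ?thesis by (rule summable_finite) auto
qed

typedef ell1 = "{f :: nat \<Rightarrow> real. summable (\<lambda>n. \<bar>f n\<bar>)}"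
  morphisms ell1_seq Abs_ell1
  by (rule exI[of _ "\<lambda>n. 0"]) simp

setup_lifting type_definition_ell1

lemma ell1_summable: "summable (\<lambda>n. \<bar>ell1_seq x n\<bar>)"
  using ell1_seq by auto

instantiation ell1 :: real_vector
begin
lift_definition zero_ell1 :: ell1 is "\<lambda>n. 0" by simp
lift_definition plus_ell1 :: "ell1 \<Rightarrow> ell1 \<Rightarrow> ell1" is "\<lambda>f g n. f n + g n"
  by (rule l1_summable_add)
lift_definition uminus_ell1 :: "ell1 \<Rightarrow> ell1" is "\<lambda>f n. - f n" by simp
lift_definition minus_ell1 :: "ell1 \<Rightarrow> ell1 \<Rightarrow> ell1" is "\<lambda>f g n. f n - g n"
  by (rule l1_summable_diff)
lift_definition scaleR_ell1 :: "real \<Rightarrow> ell1 \<Rightarrow> ell1" is "\<lambda>a f n. a * f n"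
  by (rule l1_summable_scale)
instance
  by standard (transfer; auto simp: algebra_simps fun_eq_iff)+
end

instantiation ell1 :: real_normed_vector
begin
lift_definition norm_ell1 :: "ell1 \<Rightarrow> real" is l1n .
definition dist_ell1 :: "ell1 \<Rightarrow> ell1 \<Rightarrow> real" where "dist_ell1 x y = norm (x - y)"
definition sgn_ell1 :: "ell1 \<Rightarrow> ell1" where "sgn_ell1 x = x /\<^sub>R norm x"
definition uniformity_ell1 :: "(ell1 \<times> ell1) filter"
  where "uniformity_ell1 = (INF e\<in>{0 <..}. principal {(x, y). dist x y < e})"
definition open_ell1 :: "ell1 set \<Rightarrow> bool"
  where "open_ell1 S = (\<forall>x\<in>S. \<forall>\<^sub>F (x', y) in uniformity. x' = x \<longrightarrow> y \<in> S)"
instance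
proof
  fix x y :: ell1 and a :: real
  show "norm x = 0 \<longleftrightarrow> x = 0" by transfer (simp add: l1n_eq_0)
  show "norm (x + y) \<le> norm x + norm y" by transfer (rule l1n_add)
  show "norm (a *\<^sub>R x) = \<bar>a\<bar> * norm x" by transfer (rule l1n_scale)
qed (simp_all add: dist_ell1_def sgn_ell1_def uniformity_ell1_def open_ell1_def)
end

lemma norm_ell1_eq: "norm x = (\<Sum>n. \<bar>ell1_seq x n\<bar>)"
  by transfer (simp add: l1n_def)

instance ell1 :: banach
proof
  fix X :: "nat \<Rightarrow> ell1"
  assume C: "Cauchy X"
  define x where "x m = ell1_seq (X m)" for m
  have sx: "summable (\<lambda>n. \<bar>x m n\<bar>)" for m unfolding x_def by (rule ell1_summable)
  have dnorm: "norm (X m - X n) = l1n (\<lambda>k. x m k - x n k)" for m n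
    unfolding x_def by transfer simp
  have sxd: "summable (\<lambda>k. \<bar>x m k - x n k\<bar>)" for m n by (rule l1_summable_diff[OF sx sx])
  have "Cauchy (\<lambda>m. x m k)" for k
  proof (rule CauchyI)
    fix e :: real assume "e > 0"
    then obtain M where M: "\<And>m n. m \<ge> M \<Longrightarrow> n \<ge> M \<Longrightarrow> norm (X m - X n) < e"
      using C by (metis CauchyD)
    show "\<exists>M. \<forall>m\<ge>M. \<forall>n\<ge>M. norm (x m k - x n k) < e"
    proof (intro exI allI impI)
      fix m n assume mn: "m \<ge> M" "n \<ge> M"
      have "\<bar>x m k - x n k\<bar> \<le> l1n (\<lambda>k. x m k - x n k)" by (rule l1_coord_le[OF sxd])
      also have "\<dots> < e" using M[OF mn] dnorm by simp
      finally show "norm (x m k - x n k) < e" by simp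
    qed
  qed
  then have conv: "convergent (\<lambda>m. x m k)" for k
    by (rule Cauchy_convergent)
  have "\<forall>k. \<exists>l. (\<lambda>m. x m k) \<longlonglongrightarrow> l"
  proof
    fix k show "\<exists>l. (\<lambda>m. x m k) \<longlonglongrightarrow> l" using conv[of k] unfolding convergent_def .
  qed
  from choice[OF this] obtain f where f0: "\<forall>k. (\<lambda>m. x m k) \<longlonglongrightarrow> f k" ..
  have f: "(\<lambda>m. x m k) \<longlonglongrightarrow> f k" for k using f0 by (rule spec)
  have key: "\<exists>M. \<forall>m\<ge>M. summable (\<lambda>k. \<bar>x m k - f k\<bar>) \<and> l1n (\<lambda>k. x m k - f k) \<le> e"
    if "e > 0" for e :: real
  proof -
    obtain M where M: "\<And>m n. m \<ge> M \<Longrightarrow> n \<ge> M \<Longrightarrow> norm (X m - X n) < e"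
      using C \<open>e > 0\<close> by (metis CauchyD)
    have part: "(\<Sum>k<K. \<bar>x m k - f k\<bar>) \<le> e" if "m \<ge> M" for m K
    proof -
      have lim: "(\<lambda>n. \<Sum>k<K. \<bar>x m k - x n k\<bar>) \<longlonglongrightarrow> (\<Sum>k<K. \<bar>x m k - f k\<bar>)"
        by (intro tendsto_intros f)
      have "\<exists>N. \<forall>n\<ge>N. (\<Sum>k<K. \<bar>x m k - x n k\<bar>) \<le> e"
      proof (intro exI allI impI)
        fix n assume "n \<ge> M"
        have "(\<Sum>k<K. \<bar>x m k - x n k\<bar>) \<le> l1n (\<lambda>k. x m k - x n k)"
          by (rule l1_partial_le[OF sxd])
        also have "\<dots> < e" using M[OF \<open>m \<ge> M\<close> \<open>n \<ge> M\<close>] dnorm by simp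
        finally show "(\<Sum>k<K. \<bar>x m k - x n k\<bar>) \<le> e" by simp
      qed
      with lim show ?thesis by (rule LIMSEQ_le_const2)
    qed
    show ?thesis
    proof (intro exI allI impI conjI)
      fix m assume "m \<ge> M"
      have le: "(\<Sum>k\<le>K. \<bar>x m k - f k\<bar>) \<le> e" for K
        using part[OF \<open>m \<ge> M\<close>, of "Suc K"] by (simp add: lessThan_Suc_atMost)
      show sm: "summable (\<lambda>k. \<bar>x m k - f k\<bar>)"
        by (rule bounded_imp_summable[OF _ le]) simp
      show "l1n (\<lambda>k. x m k - f k) \<le> e"
        unfolding l1n_def by (rule suminf_le_const[OF sm part[OF \<open>m \<ge> M\<close>]])
    qed
  qed
  obtain M1 where M1: "summable (\<lambda>k. \<bar>x M1 k - f k\<bar>)"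
    using key[of 1] by auto
  have sf: "summable (\<lambda>k. \<bar>f k\<bar>)"
    using l1_summable_diff[OF sx M1, of M1] by simp
  define F where "F = Abs_ell1 f"
  have FF: "ell1_seq F = f" unfolding F_def using sf by (simp add: Abs_ell1_inverse)
  have "X \<longlonglongrightarrow> F"
  proof (rule LIMSEQ_I)
    fix r :: real assume "r > 0"
    then obtain M where M: "\<And>m. m \<ge> M \<Longrightarrow> l1n (\<lambda>k. x m k - f k) \<le> r/2"
      using key[of "r/2"] by auto
    show "\<exists>no. \<forall>n\<ge>no. norm (X n - F) < r"
    proof (intro exI allI impI)
      fix n assume "n \<ge> M"
      have "norm (X n - F) = l1n (\<lambda>k. x n k - f k)"
        unfolding x_def using FF by transfer simp
      also have "\<dots> \<le> r/2" by (rule M[OF \<open>n \<ge> M\<close>])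
      finally show "norm (X n - F) < r" using \<open>r > 0\<close> by simp
    qed
  qed
  then show "convergent X" by (rule convergentI)
qed


lift_definition ell1_unit :: "nat \<Rightarrow> ell1" is "\<lambda>n k. if k = n then 1 else 0"
  by (rule l1_finite_support_summable) simp

typedef ell1_0 = "{f :: nat \<Rightarrow> real. finite {n. f n \<noteq> 0}}"
  morphisms ell1_0_seq Abs_ell1_0
  by (rule exI[of _ "\<lambda>n. 0"]) simp

setup_lifting type_definition_ell1_0

lemma fin_supp_add:
  fixes f g :: "nat \<Rightarrow> real"
  assumes "finite {n. f n \<noteq> 0}" "finite {n. g n \<noteq> 0}"
  shows "finite {n. f n + g n \<noteq> 0}"
  by (rule finite_subset[OF _ finite_UnI[OF assms]]) auto

lemma fin_supp_diff:
  fixes f g :: "nat \<Rightarrow> real"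
  assumes "finite {n. f n \<noteq> 0}" "finite {n. g n \<noteq> 0}"
  shows "finite {n. f n - g n \<noteq> 0}"
  by (rule finite_subset[OF _ finite_UnI[OF assms]]) auto

lemma fin_supp_scale:
  fixes f :: "nat \<Rightarrow> real"
  assumes "finite {n. f n \<noteq> 0}"
  shows "finite {n. a * f n \<noteq> 0}"
  by (rule finite_subset[OF _ assms]) auto

instantiation ell1_0 :: real_vector
begin
lift_definition zero_ell1_0 :: ell1_0 is "\<lambda>n. 0" by simp
lift_definition plus_ell1_0 :: "ell1_0 \<Rightarrow> ell1_0 \<Rightarrow> ell1_0" is "\<lambda>f g n. f n + g n"
  by (rule fin_supp_add)
lift_definition uminus_ell1_0 :: "ell1_0 \<Rightarrow> ell1_0" is "\<lambda>f n. - f n" by simp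
lift_definition minus_ell1_0 :: "ell1_0 \<Rightarrow> ell1_0 \<Rightarrow> ell1_0" is "\<lambda>f g n. f n - g n"
  by (rule fin_supp_diff)
lift_definition scaleR_ell1_0 :: "real \<Rightarrow> ell1_0 \<Rightarrow> ell1_0" is "\<lambda>a f n. a * f n"
  by (rule fin_supp_scale)
instance
  by standard (transfer; auto simp: algebra_simps fun_eq_iff)+
end

instantiation ell1_0 :: real_normed_vector
begin
lift_definition norm_ell1_0 :: "ell1_0 \<Rightarrow> real" is l1n .
definition dist_ell1_0 :: "ell1_0 \<Rightarrow> ell1_0 \<Rightarrow> real" where "dist_ell1_0 x y = norm (x - y)"
definition sgn_ell1_0 :: "ell1_0 \<Rightarrow> ell1_0" where "sgn_ell1_0 x = x /\<^sub>R norm x"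
definition uniformity_ell1_0 :: "(ell1_0 \<times> ell1_0) filter"
  where "uniformity_ell1_0 = (INF e\<in>{0 <..}. principal {(x, y). dist x y < e})"
definition open_ell1_0 :: "ell1_0 set \<Rightarrow> bool"
  where "open_ell1_0 S = (\<forall>x\<in>S. \<forall>\<^sub>F (x', y) in uniformity. x' = x \<longrightarrow> y \<in> S)"
instance
proof
  fix x y :: ell1_0 and a :: real
  show "norm x = 0 \<longleftrightarrow> x = 0"
    by transfer (simp add: l1n_eq_0 l1_finite_support_summable)
  show "norm (x + y) \<le> norm x + norm y"
    by transfer (rule l1n_add; rule l1_finite_support_summable)
  show "norm (a *\<^sub>R x) = \<bar>a\<bar> * norm x"
    by transfer (rule l1n_scale; rule l1_finite_support_summable)
qed (simp_all add: dist_ell1_0_def sgn_ell1_0_def uniformity_ell1_0_def open_ell1_0_def)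
end

definition lcs :: "'a::{real_vector,topological_space} itself \<Rightarrow> bool" where
  "lcs _ \<longleftrightarrow>
     continuous_on UNIV (\<lambda>p :: 'a \<times> 'a. fst p + snd p) \<and>
     continuous_on UNIV (\<lambda>p :: real \<times> 'a. fst p *\<^sub>R snd p) \<and>
     (\<forall>x y :: 'a. x \<noteq> y \<longrightarrow> (\<exists>U V. open U \<and> open V \<and> x \<in> U \<and> y \<in> V \<and> U \<inter> V = {})) \<and>
     (\<forall>U :: 'a set. open U \<and> 0 \<in> U \<longrightarrow> (\<exists>V. open V \<and> convex V \<and> 0 \<in> V \<and> V \<subseteq> U))"

definition cdual :: "('a::{real_vector,topological_space} \<Rightarrow> real) set" where
  "cdual = {\<phi>. linear \<phi> \<and> continuous_on UNIV \<phi>}"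

definition tvs_bounded :: "'a::{real_vector,topological_space} set \<Rightarrow> bool" where
  "tvs_bounded B \<longleftrightarrow> (\<forall>U. open U \<and> 0 \<in> U \<longrightarrow> (\<exists>t>0. \<forall>b\<in>B. t *\<^sub>R b \<in> U))"

definition tvs_Cauchy :: "(nat \<Rightarrow> 'a::{real_vector,topological_space}) \<Rightarrow> bool" where
  "tvs_Cauchy x \<longleftrightarrow> (\<forall>U. open U \<and> 0 \<in> U \<longrightarrow> (\<exists>N. \<forall>m\<ge>N. \<forall>n\<ge>N. x m - x n \<in> U))"

definition tvs_seq_precompact :: "'a::{real_vector,topological_space} set \<Rightarrow> bool" where
  "tvs_seq_precompact S \<longleftrightarrow>
     (\<forall>x. (\<forall>n. x n \<in> S) \<longrightarrow> (\<exists>r :: nat \<Rightarrow> nat. strict_mono r \<and> tvs_Cauchy (x \<circ> r)))"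

definition tvs_seq_precompact_op :: "('x::{real_vector,topological_space} \<Rightarrow> 'a::{real_vector,topological_space}) \<Rightarrow> bool" where
  "tvs_seq_precompact_op T \<longleftrightarrow> (\<exists>U. open U \<and> 0 \<in> U \<and> tvs_seq_precompact (T ` U))"

definition weakly_null :: "(nat \<Rightarrow> 'a::{real_vector,topological_space}) \<Rightarrow> bool" where
  "weakly_null x \<longleftrightarrow> (\<forall>\<phi>\<in>cdual. (\<lambda>n. \<phi> (x n)) \<longlonglongrightarrow> 0)"

definition weakly_Cauchy :: "(nat \<Rightarrow> 'a::{real_vector,topological_space}) \<Rightarrow> bool" where
  "weakly_Cauchy x \<longleftrightarrow> (\<forall>\<phi>\<in>cdual. Cauchy (\<lambda>n. \<phi> (x n)))"

text \<open>For q \<in> [1,\<infinity>]: membership in l_q, with c_0 in place of l_\<infinity>.\<close>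
definition in_lq :: "ereal \<Rightarrow> (nat \<Rightarrow> real) \<Rightarrow> bool" where
  "in_lq q a \<longleftrightarrow> (if q = \<infinity> then a \<longlonglongrightarrow> 0 else summable (\<lambda>n. \<bar>a n\<bar> powr real_of_ereal q))"

definition wstar_q_summable :: "ereal \<Rightarrow> (nat \<Rightarrow> 'a::{real_vector,topological_space} \<Rightarrow> real) \<Rightarrow> bool" where
  "wstar_q_summable q \<phi> \<longleftrightarrow> (\<forall>n. \<phi> n \<in> cdual) \<and> (\<forall>x. in_lq q (\<lambda>n. \<phi> n x))"

definition sup_on :: "('a::{real_vector} \<Rightarrow> real) \<Rightarrow> 'a set \<Rightarrow> ereal" where
  "sup_on \<phi> A = (SUP x\<in>insert 0 A. ereal \<bar>\<phi> x\<bar>)"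

definition q_infty_limited :: "ereal \<Rightarrow> 'a::{real_vector,topological_space} set \<Rightarrow> bool" where
  "q_infty_limited q A \<longleftrightarrow> A \<noteq> {} \<and>
     (\<forall>\<phi>. wstar_q_summable q \<phi> \<longrightarrow> (\<lambda>n. sup_on (\<phi> n) A) \<longlonglongrightarrow> 0)"

text \<open>Continuous linear functionals on E'_{w*}: the weak* topology on E' is the
  subspace topology of the pointwise (product) topology on 'a \<Rightarrow> real.\<close>
definition wstar_dual :: "(('a::{real_vector,topological_space} \<Rightarrow> real) \<Rightarrow> real) set" where
  "wstar_dual = {\<eta>. (\<forall>\<phi>\<in>cdual. \<forall>\<psi>\<in>cdual. \<forall>a b. \<eta> (\<lambda>x. a * \<phi> x + b * \<psi> x) = a * \<eta> \<phi> + b * \<eta> \<psi>)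
                      \<and> continuous_on cdual \<eta>}"

definition wstar_weakly_q_summable :: "ereal \<Rightarrow> (nat \<Rightarrow> 'a::{real_vector,topological_space} \<Rightarrow> real) \<Rightarrow> bool" where
  "wstar_weakly_q_summable q \<phi> \<longleftrightarrow> (\<forall>n. \<phi> n \<in> cdual) \<and> (\<forall>\<eta>\<in>wstar_dual. in_lq q (\<lambda>n. \<eta> (\<phi> n)))"

definition strong_dual_null :: "(nat \<Rightarrow> 'x::{real_vector,topological_space} \<Rightarrow> real) \<Rightarrow> bool" where
  "strong_dual_null \<psi> \<longleftrightarrow> (\<forall>B. tvs_bounded B \<longrightarrow> (\<lambda>n. sup_on (\<psi> n) B) \<longlonglongrightarrow> 0)"

definition dual_adjoint :: "('x \<Rightarrow> 'a) \<Rightarrow> ('a \<Rightarrow> real) \<Rightarrow> ('x \<Rightarrow> real)" where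
  "dual_adjoint T \<phi> = \<phi> \<circ> T"

definition adjoint_q_convergent :: "ereal \<Rightarrow> ('x::{real_vector,topological_space} \<Rightarrow> 'a::{real_vector,topological_space}) \<Rightarrow> bool" where
  "adjoint_q_convergent q T \<longleftrightarrow>
     (\<forall>\<phi>. wstar_weakly_q_summable q \<phi> \<longrightarrow> strong_dual_null (\<lambda>n. dual_adjoint T (\<phi> n)))"

definition abs_convex_hull :: "'a::real_vector set \<Rightarrow> 'a set" where
  "abs_convex_hull S = {y. \<exists>F c. finite F \<and> F \<subseteq> S \<and> (\<Sum>s\<in>F. \<bar>c s\<bar>) \<le> 1 \<and> y = (\<Sum>s\<in>F. c s *\<^sub>R s)}"

definition locally_complete :: "'a::{real_vector,topological_space} itself \<Rightarrow> bool" where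
  "locally_complete _ \<longleftrightarrow>
     (\<forall>x :: nat \<Rightarrow> 'a. x \<longlonglongrightarrow> 0 \<longrightarrow> compact (closure (abs_convex_hull (range x))))"

definition equiv_ell1_basis :: "(nat \<Rightarrow> 'a::{real_vector,topological_space}) \<Rightarrow> bool" where
  "equiv_ell1_basis a \<longleftrightarrow>
     (\<exists>R :: 'a \<Rightarrow> ell1. let S = closure (span (range a)) in
        (\<forall>x\<in>S. \<forall>y\<in>S. R (x + y) = R x + R y) \<and> (\<forall>c. \<forall>x\<in>S. R (c *\<^sub>R x) = c *\<^sub>R R x) \<and>
        inj_on R S \<and> continuous_on S R \<and> continuous_on (R ` S) (inv_into S R) \<and>
        subspace (R ` S) \<and> (\<forall>n. R (a n) = ell1_unit n))"

definition rosenthal_property :: "'a::{real_vector,topological_space} itself \<Rightarrow> bool" where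
  "rosenthal_property _ \<longleftrightarrow>
     (\<forall>x :: nat \<Rightarrow> 'a. tvs_bounded (range x) \<longrightarrow>
        (\<exists>r :: nat \<Rightarrow> nat. strict_mono r \<and> (weakly_Cauchy (x \<circ> r) \<or> equiv_ell1_basis (x \<circ> r))))"

end

theory Submission
  imports Defs
begin

text \<open>
  The adjoint of an operator \<open>T\<close> is \<open>q\<close>-convergent exactly when \<open>T\<close> maps bounded sets to
  \<open>(q, \<infinity>)\<close>-limited sets. A limited sequence has no subsequence equivalent to the unit basis of \<open>\<ell>\<^sub>1\<close>: embedding
  \<open>\<ell>\<^sub>1\<close> into bounded functions through the Rademacher functions and extending by Hahn--Banach yields
  functionals \<open>\<xi> n\<close> with \<open>\<xi> n (a n) = 1\<close> and \<open>\<Sum> (\<xi> n x)\<^sup>2 < \<infinity>\<close> for all \<open>x\<close>,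
  a weak* \<open>q\<close>-summable sequence since \<open>q \<ge> 2\<close>.
  So by the Rosenthal property a sequence in the image of a bounded set has a weakly Cauchy
  subsequence; differences of its terms are weakly null and limited, hence null under (i), so
  the subsequence is Cauchy. Conversely a weakly null limited sequence \<open>x\<close> is the image of the unit
  vectors under \<open>f \<mapsto> \<Sum> f n x n\<close>, and a weakly null Cauchy sequence is null. On all of \<open>\<ell>\<^sub>1\<close> this
  series converges when the space is locally complete.
\<close>


section \<open>Hahn--Banach extension\<close>

text \<open>The obstacle is that weak* summability is tested at every point of the space, not only
  on the span of the l_1-sequence. Hahn--Banach extensions of the single coordinate functionals stay
  equicontinuous, but nothing controls (\<xi> n x) as n varies for x outside the span. Sign
  combinations of coordinates, in contrast, are all bounded by one and the same seminorm, so each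
  extends with that bound; averaging the extensions against the signs recovers the coordinates, and
  orthogonality of the signs makes them square summable everywhere. This is the origin of the
  exponent 2. On the finite cube of N signs the averages are finite sums; compactness then removes
  N. In the converse direction l_1^0 is the test space because its elements give finite sums. On
  l_1, local completeness speaks only of null sequences while the given sequence is merely bounded,
  so a null factor has to be split off from the coefficients first.\<close>

text \<open>A partial functional is represented by its graph, a subspace of the product with the
  reals, so that extending means enlarging a subspace. A value at z is admissible when it lies above
  every r - p (x - z) and below every p (y + z) - s; subadditivity separates the two families, and
  homogeneity reduces an arbitrary multiple of z to z or -z.\<close>

lemma dominated_graph_extend:
  fixes p :: "'a::real_vector \<Rightarrow> real"
  assumes sub: "\<And>x y. p (x + y) \<le> p x + p y" and hom: "\<And>c x. p (c *\<^sub>R x) = \<bar>c\<bar> * p x"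
    and M: "subspace M" and dom: "\<And>x r. (x, r) \<in> M \<Longrightarrow> r \<le> p x"
  shows "\<exists>M' a. subspace M' \<and> (\<forall>x r. (x, r) \<in> M' \<longrightarrow> r \<le> p x) \<and> M \<subseteq> M' \<and> (z, a) \<in> M'"
proof -
  define L where "L = {r - p (x - z) | x r. (x, r) \<in> M}"
  have bd: "r - p (x - z) \<le> p (y + z) - s" if "(x, r) \<in> M" "(y, s) \<in> M" for x r y s
  proof -
    have "(x + y, r + s) \<in> M" using subspace_add[OF M that] by simp
    then have "r + s \<le> p ((x - z) + (y + z))" using dom by simp
    also have "\<dots> \<le> p (x - z) + p (y + z)" by (rule sub)
    finally show ?thesis by simp
  qed
  have z0: "(0, 0) \<in> M" using subspace_0[OF M] by (simp add: zero_prod_def)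
  have ne: "L \<noteq> {}" unfolding L_def using z0 by blast
  have bda: "bdd_above L" unfolding L_def bdd_above_def using bd[OF _ z0] by blast
  \<comment> \<open>The least admissible value. If z already lies in the domain, the two bounds
    force a to be the value given there.\<close>
  define a where "a = Sup L"
  have lo: "r - p (x - z) \<le> a" if "(x, r) \<in> M" for x r
    unfolding a_def using that bda by (intro cSup_upper) (auto simp: L_def)
  have hi: "a \<le> p (y + z) - s" if "(y, s) \<in> M" for y s
    unfolding a_def
  proof (rule cSup_least[OF ne])
    fix u assume "u \<in> L"
    then show "u \<le> p (y + z) - s" using bd[OF _ that] unfolding L_def by blast
  qed
  define M' where "M' = {v + t *\<^sub>R (z, a) | v t. v \<in> M}"
  have "subspace M'"
  proof (rule subspaceI)
    have "0 + 0 *\<^sub>R (z, a) \<in> M'" unfolding M'_def using subspace_0[OF M] by blast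
    then show "0 \<in> M'" by (simp del: scaleR_Pair)
  next
    fix u w assume "u \<in> M'" "w \<in> M'"
    then obtain v1 t1 v2 t2 where *: "u = v1 + t1 *\<^sub>R (z, a)" "w = v2 + t2 *\<^sub>R (z, a)" "v1 \<in> M" "v2 \<in> M"
      unfolding M'_def by auto
    have "u + w = (v1 + v2) + (t1 + t2) *\<^sub>R (z, a)"
      unfolding * by (simp add: scaleR_add_left algebra_simps del: scaleR_Pair)
    then show "u + w \<in> M'" unfolding M'_def using subspace_add[OF M *(3,4)] by blast
  next
    fix c u assume "u \<in> M'"
    then obtain v1 t1 where *: "u = v1 + t1 *\<^sub>R (z, a)" "v1 \<in> M"
      unfolding M'_def by auto
    have "c *\<^sub>R u = c *\<^sub>R v1 + (c * t1) *\<^sub>R (z, a)"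
      unfolding * by (simp add: scaleR_add_right del: scaleR_Pair)
    then show "c *\<^sub>R u \<in> M'" unfolding M'_def using subspace_scale[OF M *(2)] by blast
  qed
  moreover have "r \<le> p x" if xr: "(x, r) \<in> M'" for x r
  proof -
    obtain v t where v: "v \<in> M" "(x, r) = v + t *\<^sub>R (z, a)"
      using xr unfolding M'_def by blast
    obtain y s where "v = (y, s)" by (cases v)
    then have ys: "(y, s) \<in> M" and x: "x = y + t *\<^sub>R z" and r: "r = s + t * a"
      using v by auto
    consider "t = 0" | "t > 0" | "t < 0" by linarith
    then show ?thesis
    proof cases
      case 1 then show ?thesis using dom[OF ys] x r by simp
    next
      case 2
      have "(inverse t *\<^sub>R y, inverse t * s) \<in> M" using subspace_scale[OF M ys, of "inverse t"] by simp
      then have "a \<le> p (inverse t *\<^sub>R y + z) - inverse t * s" by (rule hi)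
      then have "t * (a + inverse t * s) \<le> t * p (inverse t *\<^sub>R y + z)" using 2 by simp
      also have "\<dots> = p (t *\<^sub>R (inverse t *\<^sub>R y + z))" using 2 by (simp add: hom)
      also have "t *\<^sub>R (inverse t *\<^sub>R y + z) = x" using 2 x by (simp add: scaleR_add_right)
      finally show ?thesis using 2 r by (simp add: algebra_simps)
    next
      case 3
      define u where "u = - t"
      have u: "u > 0" using 3 u_def by simp
      have "(inverse u *\<^sub>R y, inverse u * s) \<in> M" using subspace_scale[OF M ys, of "inverse u"] by simp
      then have "inverse u * s - p (inverse u *\<^sub>R y - z) \<le> a" by (rule lo)
      then have "u * (inverse u * s - a) \<le> u * p (inverse u *\<^sub>R y - z)" using u by simp
      also have "\<dots> = p (u *\<^sub>R (inverse u *\<^sub>R y - z))" using u by (simp add: hom)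
      also have "u *\<^sub>R (inverse u *\<^sub>R y - z) = x" using u x by (simp add: scaleR_diff_right u_def)
      finally show ?thesis using u r by (simp add: algebra_simps u_def)
    qed
  qed
  moreover have "M \<subseteq> M'"
  proof
    fix v assume "v \<in> M"
    then have "v + 0 *\<^sub>R (z, a) \<in> M'" unfolding M'_def by blast
    then show "v \<in> M'" by (simp del: scaleR_Pair)
  qed
  moreover have "(z, a) \<in> M'"
  proof -
    have "0 + 1 *\<^sub>R (z, a) \<in> M'" unfolding M'_def using subspace_0[OF M] by blast
    then show ?thesis by simp
  qed
  ultimately show ?thesis by blast
qed

text \<open>Zorn's lemma on dominated graphs. Membership in the ordered family does not ask for
  single-valuedness, so unions of chains only have to be dominated subspaces; a maximal graph is
  total by the one-step extension.\<close>

lemma hahn_banach_dominated: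
  fixes p :: "'a::real_vector \<Rightarrow> real"
  assumes sub: "\<And>x y. p (x + y) \<le> p x + p y" and hom: "\<And>c x. p (c *\<^sub>R x) = \<bar>c\<bar> * p x"
    and g: "subspace g" and dom: "\<And>x r. (x, r) \<in> g \<Longrightarrow> r \<le> p x"
  shows "\<exists>F. linear F \<and> (\<forall>x. \<bar>F x\<bar> \<le> p x) \<and> (\<forall>x r. (x, r) \<in> g \<longrightarrow> F x = r)"
proof -
  define A where "A = {M. subspace M \<and> (\<forall>x r. (x, r) \<in> M \<longrightarrow> r \<le> p x) \<and> g \<subseteq> M}"
  have "\<exists>M\<in>A. \<forall>X\<in>A. M \<subseteq> X \<longrightarrow> X = M"
  proof (rule subset_Zorn_nonempty)
    show "A \<noteq> {}" unfolding A_def using g dom by blast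
  next
    fix C assume ne: "C \<noteq> {}" and ch: "subset.chain A C"
    have CA: "\<And>M. M \<in> C \<Longrightarrow> M \<in> A" using ch by (auto simp: subset.chain_def)
    have cmp: "\<And>M N. M \<in> C \<Longrightarrow> N \<in> C \<Longrightarrow> M \<subseteq> N \<or> N \<subseteq> M"
      using ch by (auto simp: subset.chain_def)
    have "subspace (\<Union>C)"
    proof (rule subspaceI)
      show "0 \<in> \<Union>C" using ne CA subspace_0 unfolding A_def by blast
    next
      fix u w assume "u \<in> \<Union>C" "w \<in> \<Union>C"
      then obtain M N where MN: "M \<in> C" "N \<in> C" "u \<in> M" "w \<in> N" by blast
      then obtain K where "K \<in> C" "u \<in> K" "w \<in> K" using cmp by blast
      then show "u + w \<in> \<Union>C" using CA[of K] unfolding A_def by (auto intro: subspace_add)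
    next
      fix c u assume "u \<in> \<Union>C"
      then show "c *\<^sub>R u \<in> \<Union>C" using CA unfolding A_def by (auto intro: subspace_scale)
    qed
    then show "\<Union>C \<in> A" using CA ne unfolding A_def by blast
  qed
  then obtain M where MA: "M \<in> A" and mx: "\<And>X. X \<in> A \<Longrightarrow> M \<subseteq> X \<Longrightarrow> X = M" by blast
  have M: "subspace M" and Md: "\<And>x r. (x, r) \<in> M \<Longrightarrow> r \<le> p x" and gM: "g \<subseteq> M"
    using MA unfolding A_def by auto
  have ex: "\<exists>r. (x, r) \<in> M" for x
  proof -
    obtain M' a where "subspace M'" "\<forall>x r. (x, r) \<in> M' \<longrightarrow> r \<le> p x" "M \<subseteq> M'" "(x, a) \<in> M'"
      using dominated_graph_extend[OF sub hom M Md, of x] by blast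
    then show ?thesis using mx[of M'] gM unfolding A_def by blast
  qed
  have p0: "p 0 = 0" using hom[of 0 0] by simp
  \<comment> \<open>Domination alone makes the relation a function: a pair over 0 and its negative
    both have second entry at most p 0 = 0.\<close>
  have un: "r = s" if "(x, r) \<in> M" "(x, s) \<in> M" for x r s
  proof -
    have "(0, r - s) \<in> M" "(0, s - r) \<in> M"
      using subspace_diff[OF M that] subspace_diff[OF M that(2,1)] by auto
    from this[THEN Md] show ?thesis by (simp add: p0)
  qed
  define F where "F x = (THE r. (x, r) \<in> M)" for x
  have FM: "(x, F x) \<in> M" for x
    unfolding F_def using ex un by (metis (mono_tags, lifting) theI')
  have Feq: "F x = r" if "(x, r) \<in> M" for x r using un[OF FM that] .
  have "linear F"
    using subspace_add[OF M FM FM] subspace_scale[OF M FM]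
    by (intro linearI) (auto intro!: Feq)
  moreover have "\<bar>F x\<bar> \<le> p x" for x
  proof -
    have "F (- x) \<le> p (- x)" using Md[OF FM] .
    moreover have "p (- x) = p x" using hom[of "-1" x] by simp
    ultimately show ?thesis using Md[OF FM, of x] linear_neg[OF \<open>linear F\<close>, of x] by simp
  qed
  ultimately show ?thesis using Feq gM by blast
qed

section \<open>Continuous seminorms\<close>

text \<open>Continuity is encoded as a neighbourhood of zero inside the open unit ball of p. In a
  locally convex space, dilations and translations turn this into the estimate around every point
  and for every radius.\<close>

definition cseminorm :: "('a::{real_vector,topological_space} \<Rightarrow> real) \<Rightarrow> bool" where
  "cseminorm p \<longleftrightarrow> (\<forall>x y. p (x + y) \<le> p x + p y) \<and> (\<forall>c x. p (c *\<^sub>R x) = \<bar>c\<bar> * p x) \<and>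
     (\<exists>U. open U \<and> 0 \<in> U \<and> (\<forall>x\<in>U. p x < 1))"

lemma cseminorm_add: "cseminorm p \<Longrightarrow> p (x + y) \<le> p x + p y"
  and cseminorm_scale: "cseminorm p \<Longrightarrow> p (c *\<^sub>R x) = \<bar>c\<bar> * p x"
  by (auto simp: cseminorm_def)

lemma cseminorm_zero: "cseminorm p \<Longrightarrow> p 0 = 0"
  using cseminorm_scale[of p 0 0] by simp

lemma cseminorm_minus: "cseminorm p \<Longrightarrow> p (- x) = p x"
  using cseminorm_scale[of p "-1" x] by simp

lemma cseminorm_nonneg: "cseminorm p \<Longrightarrow> 0 \<le> p x"
  using cseminorm_add[of p x "-x"] by (simp add: cseminorm_minus cseminorm_zero)

lemma cseminorm_diff: "cseminorm p \<Longrightarrow> p (x - y) \<le> p x + p y"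
  using cseminorm_add[of p x "-y"] by (simp add: cseminorm_minus)

lemma cseminorm_sum: "cseminorm p \<Longrightarrow> p (sum f A) \<le> (\<Sum>i\<in>A. p (f i))"
  by (induction A rule: infinite_finite_induct)
    (auto simp: cseminorm_zero intro: order_trans[OF cseminorm_add])

text \<open>The type only carries some topology, so translations and dilations owe their continuity
  to \<open>lcs\<close>. Open sets are moved around below as preimages under these maps.\<close>

lemma lcs_continuous_affine:
  assumes "lcs TYPE('a::{real_vector,topological_space})"
  shows "continuous_on UNIV (\<lambda>y::'a. c *\<^sub>R (y - x))"
proof -
  have a: "continuous_on UNIV (\<lambda>q :: 'a \<times> 'a. fst q + snd q)"
    and s: "continuous_on UNIV (\<lambda>q :: real \<times> 'a. fst q *\<^sub>R snd q)"
    using assms unfolding lcs_def by auto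
  have 1: "continuous_on UNIV (\<lambda>y::'a. fst (y, - x) + snd (y, - x))"
    by (rule continuous_on_compose2[OF a]) (auto intro!: continuous_intros)
  have "continuous_on UNIV (\<lambda>y::'a. fst (c, y + - x) *\<^sub>R snd (c, y + - x))"
    by (rule continuous_on_compose2[OF s]) (use 1 in \<open>auto intro!: continuous_intros\<close>)
  then show ?thesis by simp
qed

lemma cseminorm_nbhd:
  fixes p :: "'a::{real_vector,topological_space} \<Rightarrow> real"
  assumes L: "lcs TYPE('a)" and p: "cseminorm p" and e: "e > 0"
  shows "\<exists>V. open V \<and> x \<in> V \<and> (\<forall>y\<in>V. p (y - x) < e)"
proof -
  obtain U where U: "open U" "0 \<in> U" "\<forall>x\<in>U. p x < 1" using p by (auto simp: cseminorm_def)
  define V where "V = (\<lambda>y. inverse e *\<^sub>R (y - x)) -` U"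
  have "open V" unfolding V_def
    using lcs_continuous_affine[OF L, of "inverse e" x] U(1) by (simp add: continuous_on_open_vimage)
  moreover have "x \<in> V" unfolding V_def using U by simp
  moreover have "p (y - x) < e" if "y \<in> V" for y
  proof -
    have "p (inverse e *\<^sub>R (y - x)) < 1" using that U(3) unfolding V_def by auto
    then have "inverse e * p (y - x) < 1" using e unfolding cseminorm_scale[OF p] by simp
    then show ?thesis using e by (simp add: field_simps)
  qed
  ultimately show ?thesis by blast
qed

text \<open>p is the Minkowski functional of a symmetric convex open neighbourhood W of zero inside
  U: convexity gives subadditivity, symmetry gives absolute homogeneity, and W absorbs every
  point.\<close>

lemma lcs_cseminorm_below:
  fixes U :: "'a::{real_vector,topological_space} set"
  assumes L: "lcs TYPE('a)" and U: "open U" "0 \<in> U"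
  shows "\<exists>p. cseminorm p \<and> (\<forall>x. p x < 1 \<longrightarrow> x \<in> U)"
proof -
  obtain V where V: "open V" "convex V" "0 \<in> V" "V \<subseteq> U"
    using L U unfolding lcs_def by blast
  define W where "W = V \<inter> uminus -` V"
  have eq: "uminus -` V = (\<lambda>y. (-1) *\<^sub>R (y - 0)) -` V" by auto
  have "open (uminus -` V)" unfolding eq
    using lcs_continuous_affine[OF L, of "-1" 0] V(1) by (simp add: continuous_on_open_vimage)
  then have W: "open W" "0 \<in> W" "W \<subseteq> U" using V by (auto simp: W_def)
  have Wn: "- x \<in> W" if "x \<in> W" for x using that by (auto simp: W_def)
  have Wc: "convex W" unfolding W_def
    using V(2) convex_linear_vimage[of uminus V] by (auto intro!: convex_Int simp: linear_uminus)
  have shr: "t *\<^sub>R x \<in> W" if "x \<in> W" "0 \<le> t" "t \<le> 1" for x t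
    using convexD[OF Wc that(1) W(2), of t "1 - t"] that by simp
  define P where "P x = {t. t > 0 \<and> inverse t *\<^sub>R x \<in> W}" for x
  define p where "p x = Inf (P x)" for x
  have bdd: "bdd_below (P x)" for x by (rule bdd_belowI[of _ 0]) (auto simp: P_def)
  have up: "s \<in> P x" if "t \<in> P x" "t \<le> s" for s t x
  proof -
    have t: "t > 0" "inverse t *\<^sub>R x \<in> W" using that by (auto simp: P_def)
    then have "(t / s) *\<^sub>R (inverse t *\<^sub>R x) \<in> W"
      using that by (intro shr[OF t(2)]) auto
    moreover have "(t / s) *\<^sub>R (inverse t *\<^sub>R x) = inverse s *\<^sub>R x"
      using t(1) by (simp add: divide_inverse)
    ultimately have "inverse s *\<^sub>R x \<in> W" by metis
    then show ?thesis using t that by (auto simp: P_def)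
  qed
  \<comment> \<open>Absorption: c \<mapsto> c x is continuous and sends 0 into W, so small multiples
    of x lie in W and the infimum is over a nonempty set.\<close>
  have ne: "P x \<noteq> {}" for x
  proof -
    have s: "continuous_on UNIV (\<lambda>q :: real \<times> 'a. fst q *\<^sub>R snd q)"
      using L unfolding lcs_def by auto
    have "continuous_on UNIV (\<lambda>c. fst (c, x) *\<^sub>R snd (c, x))"
      by (rule continuous_on_compose2[OF s]) (auto intro!: continuous_intros)
    then have "open ((\<lambda>c. c *\<^sub>R x) -` W)" using W(1) by (simp add: continuous_on_open_vimage)
    moreover have "0 \<in> (\<lambda>c. c *\<^sub>R x) -` W" using W by simp
    ultimately obtain e where e: "e > 0" "ball 0 e \<subseteq> (\<lambda>c. c *\<^sub>R x) -` W"
      using open_contains_ball by blast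
    have "e / 2 \<in> ball 0 e" using e(1) by (simp add: dist_norm)
    then have "(e / 2) *\<^sub>R x \<in> W" using e(2) by blast
    then have "inverse (e / 2) \<in> P x" using e(1) by (simp add: P_def)
    then show ?thesis by blast
  qed
  have lt: "t \<in> P x" if "p x < t" for x t
    using that up cInf_lessD[OF ne, of x t] unfolding p_def by (meson less_imp_le)
  have le: "p x \<le> t" if "t \<in> P x" for x t
    unfolding p_def using bdd that by (rule cInf_lower[rotated])
  have nonneg: "0 \<le> p x" for x
    unfolding p_def by (rule cInf_greatest[OF ne]) (auto simp: P_def)
  have add: "p (x + y) \<le> p x + p y" for x y
  proof (rule field_le_epsilon)
    fix e :: real assume e: "0 < e"
    define s t where "s = p x + e / 2" and "t = p y + e / 2"
    have st: "s > 0" "t > 0" using nonneg[of x] nonneg[of y] e by (auto simp: s_def t_def)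
    have "inverse s *\<^sub>R x \<in> W" "inverse t *\<^sub>R y \<in> W"
      using lt[of x s] lt[of y t] e by (auto simp: s_def t_def P_def)
    then have "(s / (s + t)) *\<^sub>R (inverse s *\<^sub>R x) + (t / (s + t)) *\<^sub>R (inverse t *\<^sub>R y) \<in> W"
      using st by (intro convexD[OF Wc]) (auto simp: add_divide_distrib[symmetric])
    moreover have "(s / (s + t)) *\<^sub>R (inverse s *\<^sub>R x) + (t / (s + t)) *\<^sub>R (inverse t *\<^sub>R y)
        = inverse (s + t) *\<^sub>R (x + y)"
      proof -
      have "s / (s + t) * inverse s = inverse (s + t)" "t / (s + t) * inverse t = inverse (s + t)"
        using st by (auto simp: divide_inverse)
      then show ?thesis by (simp only: scaleR_scaleR scaleR_add_right)
    qed
    ultimately have "inverse (s + t) *\<^sub>R (x + y) \<in> W" by metis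
    then have "s + t \<in> P (x + y)" using st by (simp add: P_def)
    from le[OF this] show "p (x + y) \<le> p x + p y + e" by (simp add: s_def t_def)
  qed
  have neg: "p (- x) = p x" for x
  proof -
    have "P (- x) = P x" using Wn by (force simp: P_def)
    then show ?thesis by (simp add: p_def)
  qed
  have pos: "p (c *\<^sub>R x) \<le> c * p x" if "c > 0" for c x
  proof (rule field_le_epsilon)
    fix e :: real assume e: "0 < e"
    have "p x + e / c \<in> P x" using e that by (intro lt) simp
    moreover have "inverse (c * (p x + e / c)) * c = inverse (p x + e / c)"
      using that unfolding inverse_mult_distrib by simp
    then have "inverse (c * (p x + e / c)) *\<^sub>R (c *\<^sub>R x) = inverse (p x + e / c) *\<^sub>R x"
      by (simp only: scaleR_scaleR)
    ultimately have "c * (p x + e / c) \<in> P (c *\<^sub>R x)"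
      using that unfolding P_def mem_Collect_eq by (metis mult_pos_pos)
    from le[OF this] show "p (c *\<^sub>R x) \<le> c * p x + e" using that by (simp add: distrib_left)
  qed
  have pos': "p (c *\<^sub>R x) = c * p x" if "c > 0" for c x
  proof (rule antisym[OF pos[OF that]])
    have "p (inverse c *\<^sub>R (c *\<^sub>R x)) \<le> inverse c * p (c *\<^sub>R x)" using that by (intro pos) simp
    then show "c * p x \<le> p (c *\<^sub>R x)" using that by (simp add: field_simps)
  qed
  have p0: "p 0 = 0"
  proof (rule antisym[OF _ nonneg])
    show "p 0 \<le> 0"
    proof (rule field_le_epsilon)
      fix e :: real assume "0 < e"
      then have "e \<in> P 0" using W by (simp add: P_def)
      from le[OF this] show "p 0 \<le> 0 + e" by simp
    qed
  qed
  have hom: "p (c *\<^sub>R x) = \<bar>c\<bar> * p x" for c x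
    using pos'[of c x] pos'[of "- c" x] neg[of "c *\<^sub>R x"] p0
    by (cases "c = 0"; cases "c > 0") auto
  have lt1: "x \<in> W" if "p x < 1" for x
    using lt[OF that] by (simp add: P_def)
  \<comment> \<open>On W the gauge is only seen to be at most 1; halving W gives the strict
    inequality required by \<open>cseminorm\<close>.\<close>
  define W2 where "W2 = (\<lambda>y. 2 *\<^sub>R (y - 0)) -` W"
  have "open W2" unfolding W2_def
    using lcs_continuous_affine[OF L, of 2 0] W(1) by (simp add: continuous_on_open_vimage)
  moreover have "0 \<in> W2" using W by (simp add: W2_def)
  moreover have "p x < 1" if "x \<in> W2" for x
  proof -
    have "1 / 2 \<in> P x" using that by (simp add: P_def W2_def)
    from le[OF this] show ?thesis by simp
  qed
  ultimately have "cseminorm p" unfolding cseminorm_def using add hom by blast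
  then show ?thesis using lt1 W(3) by blast
qed

section \<open>Convergence, Cauchy sequences and continuity in terms of seminorms\<close>

lemma lcs_tendsto_iff:
  fixes f :: "nat \<Rightarrow> 'a::{real_vector,topological_space}"
  assumes L: "lcs TYPE('a)"
  shows "f \<longlonglongrightarrow> l \<longleftrightarrow> (\<forall>p. cseminorm p \<longrightarrow> (\<lambda>n. p (f n - l)) \<longlonglongrightarrow> 0)"
proof safe
  fix p :: "'a \<Rightarrow> real" assume f: "f \<longlonglongrightarrow> l" and p: "cseminorm p"
  show "(\<lambda>n. p (f n - l)) \<longlonglongrightarrow> 0"
  proof (rule tendstoI)
    fix e :: real assume e: "e > 0"
    obtain V where "open V" "l \<in> V" and V: "\<forall>y\<in>V. p (y - l) < e"
      using cseminorm_nbhd[OF L p e] by blast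
    then have "eventually (\<lambda>n. f n \<in> V) sequentially" using f by (auto simp: tendsto_def)
    then show "eventually (\<lambda>n. dist (p (f n - l)) 0 < e) sequentially"
      by eventually_elim (use V cseminorm_nonneg[OF p] in auto)
  qed
next
  assume *: "\<forall>p. cseminorm p \<longrightarrow> (\<lambda>n. p (f n - l)) \<longlonglongrightarrow> 0"
  show "f \<longlonglongrightarrow> l"
  proof (rule topological_tendstoI)
    fix S assume S: "open S" "l \<in> S"
    define U where "U = (\<lambda>y. 1 *\<^sub>R (y - (- l))) -` S"
    have "open U" unfolding U_def
      using lcs_continuous_affine[OF L, of 1 "- l"] S(1) by (simp add: continuous_on_open_vimage)
    moreover have "0 \<in> U" using S by (simp add: U_def)
    ultimately obtain p where p: "cseminorm p" "\<forall>x. p x < 1 \<longrightarrow> x \<in> U"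
      using lcs_cseminorm_below[OF L] by blast
    have "eventually (\<lambda>n. p (f n - l) < 1) sequentially"
      using * p(1) by (auto intro: order_tendstoD)
    then show "eventually (\<lambda>n. f n \<in> S) sequentially"
      by eventually_elim (use p(2) in \<open>force simp: U_def\<close>)
  qed
qed

lemma lcs_separated:
  fixes x :: "'a::{real_vector,topological_space}"
  assumes L: "lcs TYPE('a)" and 0: "\<And>p. cseminorm p \<Longrightarrow> p x = 0"
  shows "x = 0"
proof (rule ccontr)
  assume "x \<noteq> 0"
  then obtain U V where "open U" "open V" "x \<in> U" "0 \<in> V" "U \<inter> V = {}"
    using L unfolding lcs_def by meson
  then show False using lcs_cseminorm_below[OF L, of V] 0 by force
qed

lemma lcs_tvs_Cauchy_iff:
  fixes f :: "nat \<Rightarrow> 'a::{real_vector,topological_space}"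
  assumes L: "lcs TYPE('a)"
  shows "tvs_Cauchy f \<longleftrightarrow> (\<forall>p e. cseminorm p \<longrightarrow> e > 0 \<longrightarrow> (\<exists>N. \<forall>m\<ge>N. \<forall>n\<ge>N. p (f m - f n) < e))"
proof safe
  fix p :: "'a \<Rightarrow> real" and e :: real assume f: "tvs_Cauchy f" and p: "cseminorm p" and e: "e > 0"
  obtain V where "open V" "0 \<in> V" "\<forall>y\<in>V. p (y - 0) < e"
    using cseminorm_nbhd[OF L p e] by blast
  then show "\<exists>N. \<forall>m\<ge>N. \<forall>n\<ge>N. p (f m - f n) < e" using f unfolding tvs_Cauchy_def by fastforce
next
  assume *: "\<forall>p e. cseminorm p \<longrightarrow> e > 0 \<longrightarrow> (\<exists>N. \<forall>m\<ge>N. \<forall>n\<ge>N. p (f m - f n) < e)"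
  show "tvs_Cauchy f" unfolding tvs_Cauchy_def
  proof safe
    fix U :: "'a set" assume "open U" "0 \<in> U"
    then obtain p where p: "cseminorm p" "\<forall>x. p x < 1 \<longrightarrow> x \<in> U"
      using lcs_cseminorm_below[OF L] by blast
    then show "\<exists>N. \<forall>m\<ge>N. \<forall>n\<ge>N. f m - f n \<in> U" using * by (meson zero_less_one)
  qed
qed

text \<open>\<open>tr\<close> expresses that translates of neighbourhoods of zero are neighbourhoods
  in the domain; it carries the estimate at zero to every point, while translation in the codomain
  comes from \<open>lcs\<close>.\<close>

lemma lcs_linear_continuous:
  fixes T :: "'x::{real_vector,topological_space} \<Rightarrow> 'a::{real_vector,topological_space}"
  assumes L: "lcs TYPE('a)" and T: "linear T"
    and tr: "\<And>(x::'x) V. open V \<Longrightarrow> 0 \<in> V \<Longrightarrow> \<exists>W. open W \<and> x \<in> W \<and> (\<forall>y\<in>W. y - x \<in> V)"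
    and bd: "\<And>p. cseminorm p \<Longrightarrow> \<exists>V. open V \<and> 0 \<in> V \<and> (\<forall>y\<in>V. p (T y) < 1)"
  shows "continuous_on UNIV T"
  unfolding continuous_on_open_vimage[OF open_UNIV] Int_UNIV_right
proof safe
  fix S :: "'a set" assume S: "open S"
  show "open (T -` S)"
  proof (subst open_subopen, safe)
    fix x assume x: "T x \<in> S"
    define U where "U = (\<lambda>y. 1 *\<^sub>R (y - (- T x))) -` S"
    have "open U" unfolding U_def
      using lcs_continuous_affine[OF L, of 1 "- T x"] S by (simp add: continuous_on_open_vimage)
    moreover have "0 \<in> U" using x by (simp add: U_def)
    ultimately obtain p where p: "cseminorm p" "\<forall>x. p x < 1 \<longrightarrow> x \<in> U"
      using lcs_cseminorm_below[OF L] by blast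
    obtain V where V: "open V" "0 \<in> V" "\<forall>y\<in>V. p (T y) < 1" using bd[OF p(1)] by blast
    obtain W where W: "open W" "x \<in> W" "\<forall>y\<in>W. y - x \<in> V" using tr[OF V(1,2)] by blast
    have "W \<subseteq> T -` S"
    proof
      fix y assume "y \<in> W"
      then have "T (y - x) \<in> U" using W V p by blast
      then show "y \<in> T -` S" by (simp add: U_def linear_diff[OF T])
    qed
    then show "\<exists>Ta. open Ta \<and> x \<in> Ta \<and> Ta \<subseteq> T -` S" using W by blast
  qed
qed

lemma lcs_linear_continuous_normed:
  fixes T :: "'x::real_normed_vector \<Rightarrow> 'a::{real_vector,topological_space}"
  assumes L: "lcs TYPE('a)" and T: "linear T"
    and bd: "\<And>p. cseminorm p \<Longrightarrow> \<exists>C. \<forall>x. p (T x) \<le> C * norm x"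
  shows "continuous_on UNIV T"
proof (rule lcs_linear_continuous[OF L T])
  fix x :: 'x and V :: "'x set" assume V: "open V" "0 \<in> V"
  have c: "continuous_on UNIV (\<lambda>y. y - x)" by (intro continuous_intros)
  have "open ((\<lambda>y. y - x) -` V)" using V(1) c by (simp add: continuous_on_open_vimage)
  then show "\<exists>W. open W \<and> x \<in> W \<and> (\<forall>y\<in>W. y - x \<in> V)"
    using V(2) by (intro exI[of _ "(\<lambda>y. y - x) -` V"]) auto
next
  fix p :: "'a \<Rightarrow> real" assume "cseminorm p"
  then obtain C where C: "\<And>x. p (T x) \<le> C * norm x" using bd by blast
  \<comment> \<open>The given C may be zero or negative; K is positive, so 1 / K is a
    radius.\<close>
  define K where "K = \<bar>C\<bar> + 1"
  have K: "K > 0" "\<And>x. p (T x) \<le> K * norm x"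
  proof -
    show "K > 0" by (simp add: K_def)
    fix x :: 'x
    have "C * norm x \<le> K * norm x" by (intro mult_right_mono) (auto simp: K_def)
    then show "p (T x) \<le> K * norm x" using C[of x] by simp
  qed
  have "p (T y) < 1" if "y \<in> ball 0 (1 / K)" for y
  proof -
    have "K * norm y < 1" using that K(1) by (simp add: field_simps)
    then show ?thesis using K(2)[of y] by linarith
  qed
  then show "\<exists>V. open V \<and> 0 \<in> V \<and> (\<forall>y\<in>V. p (T y) < 1)"
    using K(1) by (intro exI[of _ "ball 0 (1 / K)"]) auto
qed

lemma cdualI_dominated:
  fixes \<phi> :: "'a::{real_vector,topological_space} \<Rightarrow> real"
  assumes L: "lcs TYPE('a)" and l: "linear \<phi>" and p: "cseminorm p" and le: "\<And>x. \<bar>\<phi> x\<bar> \<le> C * p x"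
  shows "\<phi> \<in> cdual"
proof -
  have "continuous_on UNIV \<phi>"
    unfolding continuous_on_topological
  proof safe
    fix x and S :: "real set" assume "open S" "\<phi> x \<in> S"
    then obtain e where e: "e > 0" "ball (\<phi> x) e \<subseteq> S" using open_contains_ball by blast
    define K where "K = \<bar>C\<bar> + 1"
    have K: "K > 0" by (simp add: K_def)
    obtain V where V: "open V" "x \<in> V" "\<forall>y\<in>V. p (y - x) < e / K"
      using cseminorm_nbhd[OF L p divide_pos_pos[OF e(1) K]] by blast
    have "\<phi> y \<in> S" if "y \<in> V" for y
    proof -
      have "\<bar>\<phi> y - \<phi> x\<bar> \<le> C * p (y - x)" using le[of "y - x"] by (simp add: linear_diff[OF l])
      also have "\<dots> \<le> K * p (y - x)"
        using cseminorm_nonneg[OF p] by (intro mult_right_mono) (auto simp: K_def)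
      also have "\<dots> < e" using V that K by (auto simp: field_simps)
      finally show ?thesis using e by (auto simp: dist_real_def abs_minus_commute)
    qed
    then show "\<exists>V. open V \<and> x \<in> V \<and> (\<forall>y\<in>UNIV. y \<in> V \<longrightarrow> \<phi> y \<in> S)" using V by blast
  qed
  then show ?thesis using l by (simp add: cdual_def)
qed

text \<open>Hahn--Banach on the line through z, whose graph is the span of the single pair (z, p
  z).\<close>

lemma cdual_norming:
  fixes z :: "'a::{real_vector,topological_space}"
  assumes L: "lcs TYPE('a)" and p: "cseminorm p"
  shows "\<exists>\<phi>\<in>cdual. (\<forall>x. \<bar>\<phi> x\<bar> \<le> p x) \<and> \<phi> z = p z"
proof -
  have d: "r \<le> p x" if xr: "(x, r) \<in> span {(z, p z)}" for x r
  proof -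
    obtain k where k: "x = k *\<^sub>R z" "r = k * p z"
      using xr by (auto simp: span_singleton)
    have "k * p z \<le> \<bar>k\<bar> * p z" using cseminorm_nonneg[OF p, of z] by (intro mult_right_mono) auto
    then show ?thesis using k by (simp add: cseminorm_scale[OF p])
  qed
  obtain F where F: "linear F" "\<forall>x. \<bar>F x\<bar> \<le> p x" "\<forall>x r. (x, r) \<in> span {(z, p z)} \<longrightarrow> F x = r"
    using hahn_banach_dominated[OF cseminorm_add[OF p] cseminorm_scale[OF p] subspace_span d] by blast
  have "F \<in> cdual" using F by (intro cdualI_dominated[OF L _ p, of F 1]) auto
  moreover have "F z = p z" using F(3) by (simp add: span_base)
  ultimately show ?thesis using F(2) by blast
qed

section \<open>Summable and limited families\<close>

text \<open>The hypothesis 2 \<le> q acts through this inclusion: the terms tend to zero, hence are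
  eventually below 1, where a larger exponent gives a smaller power. For q = \<infinity> the limit
  is already the claim.\<close>

lemma in_lq_if_square_summable:
  fixes q :: ereal
  assumes q: "2 \<le> q" and a: "summable (\<lambda>n. (a n)\<^sup>2)"
  shows "in_lq q a"
proof -
  have "(\<lambda>n. sqrt ((a n)\<^sup>2)) \<longlonglongrightarrow> sqrt 0"
    by (intro tendsto_real_sqrt summable_LIMSEQ_zero[OF a])
  then have 0: "(\<lambda>n. \<bar>a n\<bar>) \<longlonglongrightarrow> 0" by simp
  show ?thesis
  proof (cases "q = \<infinity>")
    case True
    then show ?thesis using 0 by (simp add: in_lq_def tendsto_rabs_zero_iff)
  next
    case False
    then obtain r where r: "q = ereal r" "2 \<le> r" using q by (cases q) auto
    have ev: "eventually (\<lambda>n. \<bar>a n\<bar> < 1) sequentially" using 0 by (rule order_tendstoD) simp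
    have "eventually (\<lambda>n. norm (\<bar>a n\<bar> powr r) \<le> (a n)\<^sup>2) sequentially"
      using ev
    proof eventually_elim
      case (elim n)
      have "\<bar>a n\<bar> powr r \<le> \<bar>a n\<bar> powr 2" using elim r by (intro powr_mono') auto
      also have "\<dots> = (a n)\<^sup>2" by simp
      finally show ?case by simp
    qed
    then have "summable (\<lambda>n. \<bar>a n\<bar> powr r)" using a by (rule summable_comparison_test_ev)
    then show ?thesis using r by (simp add: in_lq_def)
  qed
qed

text \<open>The dominating index may change with n, as happens for a functional bounded by the
  maximum of finitely many evaluations. Summing over all of F absorbs the choice.\<close>

lemma in_lq_dominated:
  fixes q :: ereal
  assumes q: "0 \<le> q" and F: "finite F" and f: "\<And>i. i \<in> F \<Longrightarrow> in_lq q (f i)"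
    and C: "0 \<le> C" and b: "\<And>n. \<exists>i\<in>F. \<bar>b n\<bar> \<le> C * \<bar>f i n\<bar>"
  shows "in_lq q b"
proof (cases "q = \<infinity>")
  case True
  have "(\<lambda>n. \<Sum>i\<in>F. C * \<bar>f i n\<bar>) \<longlonglongrightarrow> (\<Sum>i\<in>F. C * \<bar>0\<bar>)"
    using f True by (intro tendsto_intros) (auto simp: in_lq_def)
  then have lim: "(\<lambda>n. \<Sum>i\<in>F. C * \<bar>f i n\<bar>) \<longlonglongrightarrow> 0" by simp
  have "norm (b n) \<le> (\<Sum>i\<in>F. C * \<bar>f i n\<bar>)" for n
  proof -
    obtain i where i: "i \<in> F" "\<bar>b n\<bar> \<le> C * \<bar>f i n\<bar>" using b by blast
    have "C * \<bar>f i n\<bar> \<le> (\<Sum>i\<in>F. C * \<bar>f i n\<bar>)"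
      using i F C by (intro member_le_sum[where f = "\<lambda>i. C * \<bar>f i n\<bar>"]) auto
    then show ?thesis using i by simp
  qed
  then have "b \<longlonglongrightarrow> 0" by (intro Lim_null_comparison[OF always_eventually lim]) blast
  then show ?thesis using True by (simp add: in_lq_def)
next
  case False
  then obtain r where r: "q = ereal r" "0 \<le> r" using q by (cases q) auto
  have "summable (\<lambda>n. \<Sum>i\<in>F. C powr r * \<bar>f i n\<bar> powr r)"
    using f r by (intro summable_sum summable_mult) (auto simp: in_lq_def)
  moreover have "norm (\<bar>b n\<bar> powr r) \<le> (\<Sum>i\<in>F. C powr r * \<bar>f i n\<bar> powr r)" for n
  proof -
    obtain i where i: "i \<in> F" "\<bar>b n\<bar> \<le> C * \<bar>f i n\<bar>" using b by blast
    have "\<bar>b n\<bar> powr r \<le> (C * \<bar>f i n\<bar>) powr r" using i r by (intro powr_mono2) auto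
    also have "\<dots> = C powr r * \<bar>f i n\<bar> powr r" using C by (simp add: powr_mult)
    also have "\<dots> \<le> (\<Sum>i\<in>F. C powr r * \<bar>f i n\<bar> powr r)"
      using i F by (intro member_le_sum[where f = "\<lambda>i. C powr r * \<bar>f i n\<bar> powr r"]) auto
    finally show ?thesis by simp
  qed
  ultimately have "summable (\<lambda>n. \<bar>b n\<bar> powr r)"
    by (rule summable_comparison_test')
  then show ?thesis using r by (simp add: in_lq_def)
qed

section \<open>The dual space, its weak* continuous functionals, and limited sets\<close>

lemma cdual_scale: "\<phi> \<in> cdual \<Longrightarrow> (\<lambda>x. a * \<phi> x) \<in> cdual"
  unfolding cdual_def by (auto intro!: continuous_intros linearI
      simp: linear_add linear_scale algebra_simps)

lemma cdual_zero: "(\<lambda>x. 0) \<in> cdual"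
  unfolding cdual_def by (auto intro!: linearI)

lemma cdual_at_zero: "\<phi> \<in> cdual \<Longrightarrow> \<phi> 0 = 0"
  unfolding cdual_def by (auto simp: linear_0)

text \<open>A basic neighbourhood of zero in the product topology restricts only finitely many
  coordinates. A functional bounded by 1 on it is, by scaling, controlled by the evaluations at
  those coordinates.\<close>

lemma wstar_dual_finite_bound:
  fixes \<eta> :: "('a::{real_vector,topological_space} \<Rightarrow> real) \<Rightarrow> real"
  assumes \<eta>: "\<eta> \<in> wstar_dual"
  shows "\<exists>F C. finite F \<and> C \<ge> 0 \<and> (\<forall>\<phi>\<in>cdual. \<exists>x\<in>F. \<bar>\<eta> \<phi>\<bar> \<le> C * \<bar>\<phi> x\<bar>)"
proof -
  have lin: "\<eta> (\<lambda>x. a * \<phi> x + b * \<psi> x) = a * \<eta> \<phi> + b * \<eta> \<psi>"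
    if "\<phi> \<in> cdual" "\<psi> \<in> cdual" for \<phi> \<psi> a b using \<eta> that unfolding wstar_dual_def by blast
  have cont: "continuous_on cdual \<eta>" using \<eta> unfolding wstar_dual_def by blast
  have \<eta>0: "\<eta> (\<lambda>x. 0) = 0" using lin[OF cdual_zero cdual_zero, of 0 0] by simp
  have sc: "\<eta> (\<lambda>x. a * \<phi> x) = a * \<eta> \<phi>" if "\<phi> \<in> cdual" for a \<phi>
    using lin[OF that that, of a 0] by simp
  have "0 \<in> ball (0::real) 1" "open (ball (0::real) 1)" by auto
  then obtain A where A: "open A" "(\<lambda>x. 0) \<in> A" "\<forall>\<phi>\<in>cdual. \<phi> \<in> A \<longrightarrow> \<eta> \<phi> \<in> ball 0 1"
    using cont[unfolded continuous_on_topological, rule_format, OF cdual_zero, of "ball 0 1"] \<eta>0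
    by auto
  have "openin (product_topology (\<lambda>_::'a. euclidean :: real topology) UNIV) A"
    using A(1) by (simp add: open_fun_def)
  from product_topology_open_contains_basis[OF this A(2)] obtain X where
    X: "(\<lambda>x. 0) \<in> Pi\<^sub>E UNIV X" "\<And>i. open (X i)" "finite {i. X i \<noteq> (UNIV :: real set)}" "Pi\<^sub>E UNIV X \<subseteq> A"
    by auto
  define F where "F = {i. X i \<noteq> UNIV}"
  have "\<forall>i. \<exists>e>0. ball 0 e \<subseteq> X i"
    using X(1,2) by (metis PiE_mem UNIV_I open_contains_ball)
  then obtain e where e: "\<And>i. e i > 0" "\<And>i. ball 0 (e i) \<subseteq> X i" by metis
  \<comment> \<open>The inserted 1 keeps the minimum meaningful and positive when no coordinate is
    restricted.\<close>
  define d where "d = Min (insert 1 (e ` F))"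
  have fF: "finite F" using X(3) by (simp add: F_def)
  have d: "d > 0" unfolding d_def using fF e by (subst Min_gr_iff) auto
  have de: "d \<le> e i" if "i \<in> F" for i unfolding d_def using fF that by (intro Min_le) auto
  \<comment> \<open>The point 0 makes the index set nonempty. As \<phi> vanishes there, failure of
    the bound at 0 also shows that \<open>\<eta> \<phi>\<close> is nonzero, which allows the
    normalisation below.\<close>
  have "\<exists>x\<in>insert 0 F. \<bar>\<eta> \<phi>\<bar> \<le> inverse d * \<bar>\<phi> x\<bar>" if \<phi>: "\<phi> \<in> cdual" for \<phi>
  proof (rule ccontr)
    assume "\<not> ?thesis"
    then have *: "\<And>x. x \<in> insert 0 F \<Longrightarrow> inverse d * \<bar>\<phi> x\<bar> < \<bar>\<eta> \<phi>\<bar>" by force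
    define c where "c = \<bar>\<eta> \<phi>\<bar>"
    have c: "c > 0" using *[of 0] cdual_at_zero[OF \<phi>] by (simp add: c_def)
    \<comment> \<open>Normalised so that \<eta> has modulus 1 at \<psi>, although all restricted
      coordinates of \<psi> are small enough to put it into A.\<close>
    define \<psi> where "\<psi> x = inverse c * \<phi> x" for x
    have \<psi>: "\<psi> \<in> cdual" unfolding \<psi>_def using \<phi> by (rule cdual_scale)
    have "\<psi> i \<in> X i" for i
    proof (cases "i \<in> F")
      case True
      then have "\<bar>\<phi> i\<bar> < c * d" using *[of i] d by (simp add: c_def field_simps)
      then have "\<bar>\<psi> i\<bar> < d" using c by (simp add: \<psi>_def abs_mult field_simps)
      then have "\<psi> i \<in> ball 0 (e i)" using de[OF True] by simp
      then show ?thesis using e(2) by blast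
    qed (simp add: F_def)
    then have "\<psi> \<in> A" using X(4) by auto
    then have "\<bar>\<eta> \<psi>\<bar> < 1" using A(3) \<psi> by auto
    moreover have "\<bar>\<eta> \<psi>\<bar> = 1" unfolding \<psi>_def sc[OF \<phi>] using c by (simp add: abs_mult c_def)
    ultimately show False by simp
  qed
  then show ?thesis using fF d by (intro exI[of _ "insert 0 F"] exI[of _ "inverse d"]) auto
qed

lemma evaluation_in_wstar_dual: "(\<lambda>\<phi>. \<phi> x) \<in> wstar_dual"
  unfolding wstar_dual_def
  by (auto intro: continuous_on_subset[OF continuous_on_product_coordinates])

text \<open>Evaluations are weak* continuous, and every weak* continuous functional is dominated by
  finitely many of them. Hence q-convergence of an adjoint is tested on exactly the sequences that
  define limited sets.\<close>

lemma wstar_weakly_q_summable_iff: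
  assumes "0 \<le> q"
  shows "wstar_weakly_q_summable q \<phi> \<longleftrightarrow> wstar_q_summable q \<phi>"
proof
  assume "wstar_weakly_q_summable q \<phi>"
  then show "wstar_q_summable q \<phi>"
    using evaluation_in_wstar_dual unfolding wstar_weakly_q_summable_def wstar_q_summable_def by fast
next
  assume *: "wstar_q_summable q \<phi>"
  have "in_lq q (\<lambda>n. \<eta> (\<phi> n))" if "\<eta> \<in> wstar_dual" for \<eta>
  proof -
    obtain F C where FC: "finite F" "C \<ge> 0" "\<forall>\<phi>\<in>cdual. \<exists>x\<in>F. \<bar>\<eta> \<phi>\<bar> \<le> C * \<bar>\<phi> x\<bar>"
      using wstar_dual_finite_bound[OF \<open>\<eta> \<in> wstar_dual\<close>] by blast
    show ?thesis
      using assms FC(1) _ FC(2)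
    proof (rule in_lq_dominated[where f = "\<lambda>x n. \<phi> n x"])
      show "in_lq q (\<lambda>n. \<phi> n x)" for x using * unfolding wstar_q_summable_def by blast
      show "\<exists>i\<in>F. \<bar>\<eta> (\<phi> n)\<bar> \<le> C * \<bar>\<phi> n i\<bar>" for n
        using * FC(3) unfolding wstar_q_summable_def by blast
    qed
  qed
  then show "wstar_weakly_q_summable q \<phi>"
    using * unfolding wstar_weakly_q_summable_def wstar_q_summable_def by blast
qed

text \<open>This eliminates the extended-real supremum, which may be infinite for small n. The point
  0 in \<open>sup_on\<close> contributes nothing, since the functionals vanish there.\<close>

lemma sup_on_tendsto_zero_iff:
  assumes 0: "\<And>n. \<phi> n 0 = 0"
  shows "(\<lambda>n. sup_on (\<phi> n) A) \<longlonglongrightarrow> 0 \<longleftrightarrow> (\<forall>e>0. \<exists>N. \<forall>n\<ge>N. \<forall>x\<in>A. \<bar>\<phi> n x\<bar> \<le> e)"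
proof safe
  fix e :: real assume lim: "(\<lambda>n. sup_on (\<phi> n) A) \<longlonglongrightarrow> 0" and e: "e > 0"
  have "eventually (\<lambda>n. sup_on (\<phi> n) A < ereal e) sequentially"
    using lim by (rule order_tendstoD) (use e in simp)
  then obtain N where N: "\<And>n. n \<ge> N \<Longrightarrow> sup_on (\<phi> n) A < ereal e"
    by (auto simp: eventually_sequentially)
  have "\<bar>\<phi> n x\<bar> \<le> e" if "n \<ge> N" "x \<in> A" for n x
  proof -
    have "ereal \<bar>\<phi> n x\<bar> \<le> sup_on (\<phi> n) A" unfolding sup_on_def using that by (intro SUP_upper) auto
    also have "\<dots> < ereal e" using N that by blast
    finally show ?thesis by simp
  qed
  then show "\<exists>N. \<forall>n\<ge>N. \<forall>x\<in>A. \<bar>\<phi> n x\<bar> \<le> e" by blast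
next
  assume *: "\<forall>e>0. \<exists>N. \<forall>n\<ge>N. \<forall>x\<in>A. \<bar>\<phi> n x\<bar> \<le> e"
  show "(\<lambda>n. sup_on (\<phi> n) A) \<longlonglongrightarrow> 0"
  proof (rule order_tendstoI)
    fix a :: ereal assume "a < 0"
    moreover have "0 \<le> sup_on (\<phi> n) A" for n
      unfolding sup_on_def by (rule SUP_upper2[of 0]) auto
    ultimately show "eventually (\<lambda>n. a < sup_on (\<phi> n) A) sequentially"
      by (auto intro!: always_eventually intro: less_le_trans)
  next
    fix a :: ereal assume "0 < a"
    then obtain e where e: "0 < ereal e" "ereal e < a" using ereal_dense2 by blast
    then obtain N where N: "\<forall>n\<ge>N. \<forall>x\<in>A. \<bar>\<phi> n x\<bar> \<le> e" using * by auto
    have "sup_on (\<phi> n) A \<le> ereal e" if "n \<ge> N" for n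
      unfolding sup_on_def using N that e(1) 0 by (intro SUP_least) auto
    then show "eventually (\<lambda>n. sup_on (\<phi> n) A < a) sequentially"
      using e(2) by (auto simp: eventually_sequentially intro: le_less_trans)
  qed
qed

lemma wstar_q_summable_at_zero: "wstar_q_summable q \<phi> \<Longrightarrow> \<phi> n 0 = 0"
  unfolding wstar_q_summable_def by (auto intro: cdual_at_zero)

lemma q_infty_limited_iff:
  "q_infty_limited q A \<longleftrightarrow> A \<noteq> {} \<and>
     (\<forall>\<phi>. wstar_q_summable q \<phi> \<longrightarrow> (\<forall>e>0. \<exists>N. \<forall>n\<ge>N. \<forall>x\<in>A. \<bar>\<phi> n x\<bar> \<le> e))"
  unfolding q_infty_limited_def
  by (auto simp: sup_on_tendsto_zero_iff wstar_q_summable_at_zero)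

lemma adjoint_q_convergent_iff:
  fixes T :: "'x::{real_vector,topological_space} \<Rightarrow> 'a::{real_vector,topological_space}"
  assumes q: "0 \<le> q" and T: "linear T"
  shows "adjoint_q_convergent q T \<longleftrightarrow>
     (\<forall>\<phi> B e. wstar_q_summable q \<phi> \<longrightarrow> tvs_bounded B \<longrightarrow> e > 0 \<longrightarrow>
        (\<exists>N. \<forall>n\<ge>N. \<forall>x\<in>B. \<bar>\<phi> n (T x)\<bar> \<le> e))"
proof -
  have "strong_dual_null (\<lambda>n. dual_adjoint T (\<phi> n)) \<longleftrightarrow>
      (\<forall>B. tvs_bounded B \<longrightarrow> (\<forall>e>0. \<exists>N. \<forall>n\<ge>N. \<forall>x\<in>B. \<bar>\<phi> n (T x)\<bar> \<le> e))"
    if "wstar_q_summable q \<phi>" for \<phi> :: "nat \<Rightarrow> 'a \<Rightarrow> real"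
  proof -
    have "dual_adjoint T (\<phi> n) 0 = 0" for n
      using wstar_q_summable_at_zero[OF that] linear_0[OF T] by (simp add: dual_adjoint_def)
    then show ?thesis
      unfolding strong_dual_null_def by (simp add: sup_on_tendsto_zero_iff) (simp add: dual_adjoint_def)
  qed
  then show ?thesis
    unfolding adjoint_q_convergent_def wstar_weakly_q_summable_iff[OF q] by blast
qed

section \<open>Square-summable functionals biorthogonal to an \<open>\<ell>\<^sub>1\<close>-sequence\<close>

text \<open>A sign pattern is coded by the set D of its positive positions. For fixed n < N, D
  \<mapsto> \<open>sgn_in D n\<close> is a Rademacher function on the cube
  \<open>Pow {..<N}\<close>.\<close>

definition sgn_in :: "nat set \<Rightarrow> nat \<Rightarrow> real" where
  "sgn_in D n = (if n \<in> D then 1 else -1)"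

text \<open>Orthogonality of the signs, with cross terms cancelling. The shift v is there for the
  induction: splitting off the last sign replaces v by v + c N and v - c N, and the parallelogram
  identity adds the two squares.\<close>

lemma sum_signs_square:
  "(\<Sum>D\<in>Pow {..<N}. (v + (\<Sum>n<N. c n * sgn_in D n))\<^sup>2) = 2 ^ N * (v\<^sup>2 + (\<Sum>n<N. (c n)\<^sup>2))"
proof (induction N arbitrary: v)
  case (Suc N)
  let ?P = "Pow {..<N}"
  have P: "Pow {..<Suc N} = ?P \<union> insert N ` ?P"
    by (simp add: lessThan_Suc Pow_insert)
  have dj: "?P \<inter> insert N ` ?P = {}" by auto
  have inj: "inj_on (insert N) ?P" by (rule inj_onI) (subst (asm) insert_ident, auto)
  have s1: "(\<Sum>n<N. c n * sgn_in (insert N D) n) = (\<Sum>n<N. c n * sgn_in D n)" for D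
    by (rule sum.cong) (auto simp: sgn_in_def)
  have s2: "sgn_in (insert N D) N = 1" for D by (simp add: sgn_in_def)
  have "(\<Sum>D\<in>Pow {..<Suc N}. (v + (\<Sum>n<Suc N. c n * sgn_in D n))\<^sup>2)
      = (\<Sum>D\<in>?P. (v + (\<Sum>n<Suc N. c n * sgn_in D n))\<^sup>2)
        + (\<Sum>D\<in>insert N ` ?P. (v + (\<Sum>n<Suc N. c n * sgn_in D n))\<^sup>2)"
    unfolding P by (rule sum.union_disjoint) (use dj in auto)
  also have "(\<Sum>D\<in>insert N ` ?P. (v + (\<Sum>n<Suc N. c n * sgn_in D n))\<^sup>2)
      = (\<Sum>D\<in>?P. ((v + c N) + (\<Sum>n<N. c n * sgn_in D n))\<^sup>2)"
    unfolding sum.reindex[OF inj] by (simp add: s1 s2 add_ac)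
  also have "\<dots> = 2 ^ N * ((v + c N)\<^sup>2 + (\<Sum>n<N. (c n)\<^sup>2))" by (rule Suc.IH)
  also have "(\<Sum>D\<in>?P. (v + (\<Sum>n<Suc N. c n * sgn_in D n))\<^sup>2)
      = (\<Sum>D\<in>?P. ((v - c N) + (\<Sum>n<N. c n * sgn_in D n))\<^sup>2)"
    by (rule sum.cong) (auto simp: sgn_in_def algebra_simps)
  also have "\<dots> = 2 ^ N * ((v - c N)\<^sup>2 + (\<Sum>n<N. (c n)\<^sup>2))" by (rule Suc.IH)
  finally show ?case by (simp add: power2_eq_square algebra_simps)
qed simp

text \<open>Each sign pattern on the coordinates of an \<open>\<ell>\<^sub>1\<close>-dominated family extends by Hahn--Banach;
  the Rademacher coefficients of these extensions satisfy Bessel's inequality.\<close>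

lemma rademacher_functionals:
  fixes p :: "'a::real_vector \<Rightarrow> real" and u :: "nat \<Rightarrow> 'a \<Rightarrow> real"
  assumes sub: "\<And>x y. p (x + y) \<le> p x + p y" and hom: "\<And>c x. p (c *\<^sub>R x) = \<bar>c\<bar> * p x"
    and S: "subspace S"
    and add: "\<And>n x y. x \<in> S \<Longrightarrow> y \<in> S \<Longrightarrow> u n (x + y) = u n x + u n y"
    and scale: "\<And>n c x. x \<in> S \<Longrightarrow> u n (c *\<^sub>R x) = c * u n x"
    and le: "\<And>x. x \<in> S \<Longrightarrow> (\<Sum>n<N. \<bar>u n x\<bar>) \<le> p x"
    and b: "\<And>n. b n \<in> S" and bi: "\<And>m n. u m (b n) = (if m = n then 1 else 0)"
  shows "\<exists>\<xi>. (\<forall>n. linear (\<xi> n)) \<and> (\<forall>n x. \<bar>\<xi> n x\<bar> \<le> p x) \<and>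
    (\<forall>x. (\<Sum>n<N. (\<xi> n x)\<^sup>2) \<le> (p x)\<^sup>2) \<and> (\<forall>n<N. \<xi> n (b n) = 1)"
proof -
  have "\<forall>D. \<exists>F. linear F \<and> (\<forall>x. \<bar>F x\<bar> \<le> p x) \<and> (\<forall>x\<in>S. F x = (\<Sum>n<N. sgn_in D n * u n x))"
  proof
    fix D
    let ?f = "\<lambda>x. \<Sum>n<N. sgn_in D n * u n x"
    have g: "subspace ((\<lambda>x. (x, ?f x)) ` S)"
    proof (rule subspaceI)
      have "?f 0 = 0" using scale[OF subspace_0[OF S], of _ 0] by simp
      then show "0 \<in> (\<lambda>x. (x, ?f x)) ` S"
        using subspace_0[OF S] by (auto simp: image_iff zero_prod_def)
    next
      fix v w assume "v \<in> (\<lambda>x. (x, ?f x)) ` S" "w \<in> (\<lambda>x. (x, ?f x)) ` S"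
      then obtain x y where xy: "x \<in> S" "y \<in> S" "v = (x, ?f x)" "w = (y, ?f y)" by blast
      have "?f (x + y) = ?f x + ?f y"
        by (simp add: add xy sum.distrib algebra_simps)
      then have "v + w = (x + y, ?f (x + y))" using xy by simp
      then show "v + w \<in> (\<lambda>x. (x, ?f x)) ` S" using subspace_add[OF S xy(1,2)] by blast
    next
      fix c v assume "v \<in> (\<lambda>x. (x, ?f x)) ` S"
      then obtain x where xy: "x \<in> S" "v = (x, ?f x)" by blast
      have "?f (c *\<^sub>R x) = c * ?f x"
        by (simp add: scale xy sum_distrib_left algebra_simps)
      then have "c *\<^sub>R v = (c *\<^sub>R x, ?f (c *\<^sub>R x))" using xy by simp
      then show "c *\<^sub>R v \<in> (\<lambda>x. (x, ?f x)) ` S" using subspace_scale[OF S xy(1)] by blast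
    qed
    have d: "r \<le> p x" if "(x, r) \<in> (\<lambda>x. (x, ?f x)) ` S" for x r
    proof -
      have x: "x \<in> S" "r = ?f x" using that by auto
      have "?f x \<le> (\<Sum>n<N. \<bar>u n x\<bar>)" by (rule sum_mono) (auto simp: sgn_in_def)
      then show ?thesis using le[OF x(1)] x(2) by simp
    qed
    show "\<exists>F. linear F \<and> (\<forall>x. \<bar>F x\<bar> \<le> p x) \<and> (\<forall>x\<in>S. F x = ?f x)"
      using hahn_banach_dominated[OF sub hom g d] by blast
  qed
  from choice[OF this] obtain F where
    *: "\<forall>D. linear (F D) \<and> (\<forall>x. \<bar>F D x\<bar> \<le> p x) \<and> (\<forall>x\<in>S. F D x = (\<Sum>n<N. sgn_in D n * u n x))" ..
  have F: "\<And>D. linear (F D)" "\<And>D x. \<bar>F D x\<bar> \<le> p x"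
    "\<And>D x. x \<in> S \<Longrightarrow> F D x = (\<Sum>n<N. sgn_in D n * u n x)" using * by auto
  define P where "P = Pow {..<N}"
  have cP: "card P = 2 ^ N" by (simp add: P_def card_Pow)
  \<comment> \<open>The n-th Rademacher coefficient of D \<mapsto> \<open>F D x\<close>, that is,
    its average against the n-th sign.\<close>
  define \<xi> where "\<xi> n x = (\<Sum>D\<in>P. sgn_in D n * F D x) / 2 ^ N" for n x
  have "linear (\<xi> n)" for n
    by (rule linearI) (simp_all add: \<xi>_def linear_add[OF F(1)] linear_scale[OF F(1)] sum.distrib
        sum_distrib_left algebra_simps add_divide_distrib)
  \<comment> \<open>Valid for n \<ge> N as well; this bound, independent of N, later places all
    stages in one compact product.\<close>
  moreover have "\<bar>\<xi> n x\<bar> \<le> p x" for n x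
  proof -
    have "\<bar>\<Sum>D\<in>P. sgn_in D n * F D x\<bar> \<le> (\<Sum>D\<in>P. p x)"
      by (rule order_trans[OF sum_abs sum_mono]) (use F(2) in \<open>auto simp: sgn_in_def\<close>)
    also have "\<dots> = 2 ^ N * p x" by (simp add: cP)
    finally show ?thesis by (simp add: \<xi>_def abs_divide field_simps)
  qed
  moreover have "(\<Sum>n<N. (\<xi> n x)\<^sup>2) \<le> (p x)\<^sup>2" for x
  proof -
    define c where "c n = \<xi> n x" for n
    have c: "(\<Sum>D\<in>P. sgn_in D n * F D x) = 2 ^ N * c n" for n by (simp add: c_def \<xi>_def)
    \<comment> \<open>Bessel's inequality without an inner product space: the square sum is paired
      with \<open>F D x\<close>, the product is split by 2ab \<le> a^2 + b^2, and half of the square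
      sum is absorbed on the left.\<close>
    have "2 ^ N * (\<Sum>n<N. (c n)\<^sup>2) = (\<Sum>n<N. c n * (2 ^ N * c n))"
      by (simp add: sum_distrib_left power2_eq_square algebra_simps)
    also have "\<dots> = (\<Sum>n<N. \<Sum>D\<in>P. c n * sgn_in D n * F D x)"
      unfolding c[symmetric] by (simp add: sum_distrib_left algebra_simps)
    also have "\<dots> = (\<Sum>D\<in>P. (\<Sum>n<N. c n * sgn_in D n) * F D x)"
      by (subst sum.swap) (simp add: sum_distrib_right)
    also have "\<dots> \<le> (\<Sum>D\<in>P. ((0 + (\<Sum>n<N. c n * sgn_in D n))\<^sup>2 + (p x)\<^sup>2) / 2)"
    proof (rule sum_mono)
      fix D
      let ?s = "\<Sum>n<N. c n * sgn_in D n"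
      have "(F D x)\<^sup>2 \<le> (p x)\<^sup>2" using F(2)[of D x] by (metis abs_ge_zero power2_abs power_mono)
      moreover have "2 * ?s * F D x \<le> ?s\<^sup>2 + (F D x)\<^sup>2" by (rule sum_squares_bound)
      ultimately show "?s * F D x \<le> ((0 + ?s)\<^sup>2 + (p x)\<^sup>2) / 2" by simp
    qed
    also have "\<dots> = (2 ^ N * (\<Sum>n<N. (c n)\<^sup>2) + 2 ^ N * (p x)\<^sup>2) / 2"
      unfolding sum_divide_distrib[symmetric] sum.distrib
      using sum_signs_square[where v = 0 and c = c and N = N] by (simp add: P_def card_Pow)
    finally have "2 ^ N * (\<Sum>n<N. (c n)\<^sup>2) \<le> 2 ^ N * (p x)\<^sup>2" by simp
    then show ?thesis by (simp add: c_def)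
  qed
  moreover have "\<xi> n (b n) = 1" if n: "n < N" for n
  proof -
    have "F D (b n) = sgn_in D n" for D
    proof -
      have "F D (b n) = (\<Sum>m<N. if m = n then sgn_in D m else 0)"
        unfolding F(3)[OF b] by (rule sum.cong) (auto simp: bi)
      then show ?thesis using n by simp
    qed
    moreover have "sgn_in D n * sgn_in D n = 1" for D by (simp add: sgn_in_def)
    ultimately show ?thesis by (simp add: \<xi>_def cP)
  qed
  ultimately show ?thesis by blast
qed

section \<open>From N functionals to infinitely many, by compactness\<close>

text \<open>A cluster point stands in for a convergent subsequence, which compactness of a large
  product does not provide. Its description by closed sets is the form in which identities and
  inequalities pass to it.\<close>

lemma compact_sequence_cluster:
  assumes K: "compact K" and X: "\<And>n::nat. X n \<in> K"
  shows "\<exists>g\<in>K. \<forall>C. closed C \<longrightarrow> eventually (\<lambda>n. X n \<in> C) sequentially \<longrightarrow> g \<in> C"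
proof -
  let ?F = "filtermap X sequentially"
  have "?F \<noteq> bot" by (simp add: filtermap_bot_iff)
  moreover have "eventually (\<lambda>x. x \<in> K) ?F" using X by (simp add: eventually_filtermap)
  ultimately obtain g where g: "g \<in> K" "inf (nhds g) ?F \<noteq> bot"
    using K unfolding compact_filter by blast
  have "g \<in> C" if C: "closed C" and ev: "eventually (\<lambda>n. X n \<in> C) sequentially" for C
  proof (rule ccontr)
    assume "g \<notin> C"
    then have "eventually (\<lambda>x. x \<in> - C) (nhds g)"
      using C by (intro eventually_nhds_in_open) auto
    then have 1: "eventually (\<lambda>x. x \<in> - C) (inf (nhds g) ?F)" by (rule filter_leD[OF inf_le1])
    have "eventually (\<lambda>x. x \<in> C) ?F" using ev by (simp add: eventually_filtermap)
    then have 2: "eventually (\<lambda>x. x \<in> C) (inf (nhds g) ?F)" by (rule filter_leD[OF inf_le2])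
    have "eventually (\<lambda>x. False) (inf (nhds g) ?F)"
      using eventually_conj[OF 1 2] by simp
    then show False using g(2) by (simp add: trivial_limit_def)
  qed
  then show ?thesis using g(1) by blast
qed

text \<open>Tychonoff's theorem: all stages lie in the product of the intervals [-p x, p x]. Each
  required property is a closed condition on finitely many coordinates that holds from some stage
  on, so a cluster point has them all.\<close>

lemma rademacher_functionals_infinite:
  fixes p :: "'a::real_vector \<Rightarrow> real" and u :: "nat \<Rightarrow> 'a \<Rightarrow> real"
  assumes sub: "\<And>x y. p (x + y) \<le> p x + p y" and hom: "\<And>c x. p (c *\<^sub>R x) = \<bar>c\<bar> * p x"
    and S: "subspace S"
    and add: "\<And>n x y. x \<in> S \<Longrightarrow> y \<in> S \<Longrightarrow> u n (x + y) = u n x + u n y"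
    and scale: "\<And>n c x. x \<in> S \<Longrightarrow> u n (c *\<^sub>R x) = c * u n x"
    and le: "\<And>N x. x \<in> S \<Longrightarrow> (\<Sum>n<N. \<bar>u n x\<bar>) \<le> p x"
    and b: "\<And>n. b n \<in> S" and bi: "\<And>m n. u m (b n) = (if m = n then 1 else 0)"
  shows "\<exists>\<xi>. (\<forall>n. linear (\<xi> n)) \<and> (\<forall>n x. \<bar>\<xi> n x\<bar> \<le> p x) \<and>
    (\<forall>N x. (\<Sum>n<N. (\<xi> n x)\<^sup>2) \<le> (p x)\<^sup>2) \<and> (\<forall>n. \<xi> n (b n) = 1)"
proof -
  have "\<forall>N. \<exists>\<xi>. (\<forall>n. linear (\<xi> n)) \<and> (\<forall>n x. \<bar>\<xi> n x\<bar> \<le> p x) \<and>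
    (\<forall>x. (\<Sum>n<N. (\<xi> n x)\<^sup>2) \<le> (p x)\<^sup>2) \<and> (\<forall>n<N. \<xi> n (b n) = 1)"
    by (intro allI rademacher_functionals[OF sub hom S add scale le b bi])
  from choice[OF this] obtain \<xi> where
    *: "\<forall>N. (\<forall>n. linear (\<xi> N n)) \<and> (\<forall>n x. \<bar>\<xi> N n x\<bar> \<le> p x) \<and>
      (\<forall>x. (\<Sum>n<N. (\<xi> N n x)\<^sup>2) \<le> (p x)\<^sup>2) \<and> (\<forall>n<N. \<xi> N n (b n) = 1)" ..
  have \<xi>: "\<And>N n. linear (\<xi> N n)" "\<And>N n x. \<bar>\<xi> N n x\<bar> \<le> p x"
    "\<And>N x. (\<Sum>n<N. (\<xi> N n x)\<^sup>2) \<le> (p x)\<^sup>2" "\<And>N n. n < N \<Longrightarrow> \<xi> N n (b n) = 1" using * by auto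
  \<comment> \<open>Uncurried, so that the whole sequence of functionals is one point of a single
    product of real lines.\<close>
  define X where "X N = (\<lambda>(n, x). \<xi> N n x)" for N
  define K where "K = Pi\<^sub>E (UNIV :: (nat \<times> 'a) set) (\<lambda>z. {- p (snd z)..p (snd z)})"
  have "compactin (product_topology (\<lambda>_. euclidean) UNIV) K"
    unfolding K_def compactin_PiE by simp
  then have "compact K" by (simp add: euclidean_product_topology)
  moreover have "X N \<in> K" for N
    unfolding K_def X_def using \<xi>(2) by (auto simp: abs_le_iff minus_le_iff)
  ultimately obtain g where gK: "g \<in> K" and
    g: "\<And>C. closed C \<Longrightarrow> eventually (\<lambda>N. X N \<in> C) sequentially \<Longrightarrow> g \<in> C"
    using compact_sequence_cluster[of K X] by blast
  have co: "continuous_on UNIV (\<lambda>h. h z)" for z :: "nat \<times> 'a"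
    by (rule continuous_on_product_coordinates)
  have "linear (\<lambda>x. g (n, x))" for n
  proof (rule linearI)
    fix x y
    have "g \<in> {h. h (n, x + y) = h (n, x) + h (n, y)}"
      by (rule g) (auto intro!: closed_Collect_eq continuous_on_add co always_eventually
          simp: X_def linear_add[OF \<xi>(1)])
    then show "g (n, x + y) = g (n, x) + g (n, y)" by simp
  next
    fix c x
    have "g \<in> {h. h (n, c *\<^sub>R x) = c * h (n, x)}"
      by (rule g) (auto intro!: closed_Collect_eq continuous_on_mult continuous_on_const co always_eventually
          simp: X_def linear_scale[OF \<xi>(1)])
    then show "g (n, c *\<^sub>R x) = c *\<^sub>R g (n, x)" by simp
  qed
  moreover have "\<bar>g (n, x)\<bar> \<le> p x" for n x
    using PiE_mem[OF gK[unfolded K_def], of "(n, x)"] by auto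
  \<comment> \<open>Squares are nonnegative, so the bound at stage M controls the first N squares
    for every M \<ge> N.\<close>
  moreover have "(\<Sum>n<N. (g (n, x))\<^sup>2) \<le> (p x)\<^sup>2" for N x
  proof -
    have "(\<Sum>n<N. (\<xi> M n x)\<^sup>2) \<le> (p x)\<^sup>2" if "M \<ge> N" for M
    proof -
      have "(\<Sum>n<N. (\<xi> M n x)\<^sup>2) \<le> (\<Sum>n<M. (\<xi> M n x)\<^sup>2)" using that by (intro sum_mono2) auto
      then show ?thesis using \<xi>(3)[of M x] by simp
    qed
    then have "g \<in> {h. (\<Sum>n<N. (h (n, x))\<^sup>2) \<le> (p x)\<^sup>2}"
      by (intro g) (auto intro!: closed_Collect_le continuous_on_sum continuous_on_power continuous_on_const co
          simp: X_def eventually_sequentially)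
    then show ?thesis by simp
  qed
  moreover have "g (n, b n) = 1" for n
  proof -
    \<comment> \<open>The normalisation at index n holds only at stages beyond n, hence the
      threshold \<open>Suc n\<close>.\<close>
    have "g \<in> {h. h (n, b n) = 1}"
      by (rule g) (auto intro!: closed_Collect_eq continuous_on_const co exI[of _ "Suc n"]
          simp: X_def eventually_sequentially \<xi>(4))
    then show ?thesis by simp
  qed
  ultimately show ?thesis by (intro exI[of _ "\<lambda>n x. g (n, x)"]) simp
qed

section \<open>Application to sequences equivalent to the unit basis of l_1\<close>

text \<open>R is controlled on the closed span only. Its continuity at zero nevertheless yields a
  neighbourhood of zero in the whole space, hence a seminorm defined everywhere that dominates the
  l_1-norm on the span, as Hahn--Banach requires.\<close>

lemma ell1_basis_seminorm:
  fixes a :: "nat \<Rightarrow> 'a::{real_vector,topological_space}"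
  assumes L: "lcs TYPE('a)" and a: "equiv_ell1_basis a"
  shows "\<exists>(R :: 'a \<Rightarrow> ell1) p. cseminorm p \<and>
    (\<forall>x\<in>span (range a). \<forall>y\<in>span (range a). R (x + y) = R x + R y) \<and>
    (\<forall>c. \<forall>x\<in>span (range a). R (c *\<^sub>R x) = c *\<^sub>R R x) \<and>
    (\<forall>x\<in>span (range a). norm (R x) \<le> p x) \<and> (\<forall>n. R (a n) = ell1_unit n)"
proof -
  define S where "S = closure (span (range a))"
  have sub: "x \<in> S" if "x \<in> span (range a)" for x unfolding S_def using that closure_subset by blast
  obtain R :: "'a \<Rightarrow> ell1" where R: "\<And>x y. x \<in> S \<Longrightarrow> y \<in> S \<Longrightarrow> R (x + y) = R x + R y"
    "\<And>c x. x \<in> S \<Longrightarrow> R (c *\<^sub>R x) = c *\<^sub>R R x" "continuous_on S R" "\<And>n. R (a n) = ell1_unit n"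
    using a unfolding equiv_ell1_basis_def Let_def S_def by blast
  have z: "0 \<in> S" by (rule sub) (rule span_zero)
  have R0: "R 0 = 0" using R(2)[OF z, of 0] by simp
  have "open (ball (0::ell1) 1)" "R 0 \<in> ball 0 1" by (auto simp: R0)
  then obtain U where U: "open U" "0 \<in> U" "\<And>x. x \<in> S \<Longrightarrow> x \<in> U \<Longrightarrow> R x \<in> ball 0 1"
    using R(3) z unfolding continuous_on_topological by metis
  obtain p where p: "cseminorm p" "\<And>x. p x < 1 \<Longrightarrow> x \<in> U"
    using lcs_cseminorm_below[OF L U(1,2)] by blast
  have "norm (R x) \<le> p x" if x: "x \<in> span (range a)" for x
  proof (rule field_le_epsilon)
    fix e :: real assume "e > 0"
    \<comment> \<open>Slightly more than p x, so that dividing by c lands strictly inside the unit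
      ball of p even when p x = 0.\<close>
    define c where "c = p x + e"
    have c: "c > 0" "p x < c" using \<open>e > 0\<close> cseminorm_nonneg[OF p(1), of x] by (auto simp: c_def)
    have "p (inverse c *\<^sub>R x) < 1" using c by (simp add: cseminorm_scale[OF p(1)] field_simps)
    then have "R (inverse c *\<^sub>R x) \<in> ball 0 1"
      by (intro U(3) p(2)) (auto intro: sub span_scale x)
    then have "inverse c * norm (R x) < 1" using c(1) by (simp add: R(2)[OF sub[OF x]])
    then show "norm (R x) \<le> p x + e" using c(1) by (simp add: field_simps c_def)
  qed
  then show ?thesis using p(1) R sub by (intro exI[of _ R] exI[of _ p]) auto
qed

lemma ell1_basis_square_summable_functionals:
  fixes a :: "nat \<Rightarrow> 'a::{real_vector,topological_space}"
  assumes L: "lcs TYPE('a)" and a: "equiv_ell1_basis a"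
  shows "\<exists>\<xi>. (\<forall>n. \<xi> n \<in> cdual) \<and> (\<forall>x. summable (\<lambda>n. (\<xi> n x)\<^sup>2)) \<and> (\<forall>n. \<xi> n (a n) = 1)"
proof -
  let ?S = "span (range a)"
  obtain R :: "'a \<Rightarrow> ell1" and p where p: "cseminorm p"
    and R: "\<And>x y. x \<in> ?S \<Longrightarrow> y \<in> ?S \<Longrightarrow> R (x + y) = R x + R y"
      "\<And>c x. x \<in> ?S \<Longrightarrow> R (c *\<^sub>R x) = c *\<^sub>R R x"
      "\<And>x. x \<in> ?S \<Longrightarrow> norm (R x) \<le> p x" "\<And>n. R (a n) = ell1_unit n"
    using ell1_basis_seminorm[OF L a] by blast
  have le: "(\<Sum>n<N. \<bar>ell1_seq (R x) n\<bar>) \<le> p x" if "x \<in> ?S" for N x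
    using l1_partial_le[OF ell1_summable, of "R x" N] R(3)[OF that]
    by (simp add: norm_ell1_eq l1n_def)
  have "\<exists>\<xi>. (\<forall>n. linear (\<xi> n)) \<and> (\<forall>n x. \<bar>\<xi> n x\<bar> \<le> p x) \<and>
    (\<forall>N x. (\<Sum>n<N. (\<xi> n x)\<^sup>2) \<le> (p x)\<^sup>2) \<and> (\<forall>n. \<xi> n (a n) = 1)"
  proof (rule rademacher_functionals_infinite[where u = "\<lambda>n x. ell1_seq (R x) n" and S = ?S])
    show "ell1_seq (R (x + y)) n = ell1_seq (R x) n + ell1_seq (R y) n" if "x \<in> ?S" "y \<in> ?S" for n x y
      by (simp add: R(1)[OF that] plus_ell1.rep_eq)
    show "ell1_seq (R (c *\<^sub>R x)) n = c * ell1_seq (R x) n" if "x \<in> ?S" for n c x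
      by (simp add: R(2)[OF that] scaleR_ell1.rep_eq)
    show "ell1_seq (R (a n)) m = (if m = n then 1 else 0)" for m n
      by (simp add: R(4) ell1_unit.rep_eq)
  qed (auto simp: cseminorm_add[OF p] cseminorm_scale[OF p] le span_base)
  then obtain \<xi> where \<xi>: "\<And>n. linear (\<xi> n)" "\<And>n x. \<bar>\<xi> n x\<bar> \<le> p x"
    "\<And>N x. (\<Sum>n<N. (\<xi> n x)\<^sup>2) \<le> (p x)\<^sup>2" "\<And>n. \<xi> n (a n) = 1"
    by blast
  have "\<xi> n \<in> cdual" for n
    using \<xi>(1,2) by (intro cdualI_dominated[OF L _ p, of _ 1]) auto
  moreover have "summable (\<lambda>n. (\<xi> n x)\<^sup>2)" for x
  proof (rule bounded_imp_summable)
    show "(\<Sum>n\<le>N. (\<xi> n x)\<^sup>2) \<le> (p x)\<^sup>2" for N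
      using \<xi>(3)[of x "Suc N"] by (simp only: lessThan_Suc_atMost)
  qed simp
  ultimately show ?thesis using \<xi>(4) by blast
qed

lemma limited_not_ell1_basis:
  fixes a :: "nat \<Rightarrow> 'a::{real_vector,topological_space}"
  assumes L: "lcs TYPE('a)" and q: "2 \<le> q" and A: "q_infty_limited q A" and aA: "\<And>n. a n \<in> A"
  shows "\<not> equiv_ell1_basis a"
proof
  assume "equiv_ell1_basis a"
  then obtain \<xi> where \<xi>: "\<And>n. \<xi> n \<in> cdual" "\<And>x. summable (\<lambda>n. (\<xi> n x)\<^sup>2)" "\<And>n. \<xi> n (a n) = 1"
    using ell1_basis_square_summable_functionals[OF L] by blast
  have "wstar_q_summable q \<xi>"
    using \<xi> in_lq_if_square_summable[OF q] by (auto simp: wstar_q_summable_def)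
  moreover have "(1/2 :: real) > 0" by simp
  ultimately obtain N where "\<forall>n\<ge>N. \<forall>x\<in>A. \<bar>\<xi> n x\<bar> \<le> 1/2"
    using A unfolding q_infty_limited_iff by blast
  then have "\<bar>\<xi> N (a N)\<bar> \<le> 1/2" using aA by blast
  then show False by (simp add: \<xi>(3))
qed

section \<open>Limited weakly null sequences and operators\<close>

lemma adjoint_q_convergent_limited_image:
  assumes "0 \<le> q" "linear T" "adjoint_q_convergent q T" "tvs_bounded B" "B \<noteq> {}"
  shows "q_infty_limited q (T ` B)"
  using assms unfolding q_infty_limited_iff adjoint_q_convergent_iff[OF assms(1,2)] by auto

lemma q_infty_limited_range_diff:
  assumes A: "q_infty_limited q A" and xy: "\<And>k::nat. x k \<in> A" "\<And>k. y k \<in> A"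
  shows "q_infty_limited q (range (\<lambda>k. x k - y k))"
proof -
  have "\<exists>N. \<forall>n\<ge>N. \<forall>z\<in>range (\<lambda>k. x k - y k). \<bar>\<phi> n z\<bar> \<le> e"
    if \<phi>: "wstar_q_summable q \<phi>" and e: "e > 0" for \<phi> and e :: real
  proof -
    have "e / 2 > 0" using e by simp
    then obtain N where N: "\<forall>n\<ge>N. \<forall>z\<in>A. \<bar>\<phi> n z\<bar> \<le> e / 2"
      using A \<phi> unfolding q_infty_limited_iff by blast
    have lin: "linear (\<phi> n)" for n using \<phi> by (simp add: wstar_q_summable_def cdual_def)
    have "\<bar>\<phi> n (x k - y k)\<bar> \<le> e" if "n \<ge> N" for n k
    proof -
      have "\<bar>\<phi> n (x k)\<bar> \<le> e / 2" "\<bar>\<phi> n (y k)\<bar> \<le> e / 2" using N that xy by auto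
      then show ?thesis by (simp add: linear_diff[OF lin])
    qed
    then show ?thesis by blast
  qed
  then show ?thesis unfolding q_infty_limited_iff by blast
qed

text \<open>The index sequences need not increase: failure of the Cauchy condition supplies pairs
  beyond k without any order between them.\<close>

lemma weakly_Cauchy_diff_null:
  fixes y :: "nat \<Rightarrow> 'a::{real_vector,topological_space}"
  assumes y: "weakly_Cauchy y" and mn: "\<And>k. m k \<ge> k" "\<And>k. n k \<ge> k"
  shows "weakly_null (\<lambda>k. y (m k) - y (n k))"
  unfolding weakly_null_def
proof
  fix \<phi> :: "'a \<Rightarrow> real" assume \<phi>: "\<phi> \<in> cdual"
  then have lin: "linear \<phi>" by (simp add: cdual_def)
  have C: "Cauchy (\<lambda>n. \<phi> (y n))" using y \<phi> by (simp add: weakly_Cauchy_def)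
  show "(\<lambda>k. \<phi> (y (m k) - y (n k))) \<longlonglongrightarrow> 0"
  proof (rule LIMSEQ_I)
    fix e :: real assume "e > 0"
    then obtain N where N: "\<And>i j. i \<ge> N \<Longrightarrow> j \<ge> N \<Longrightarrow> norm (\<phi> (y i) - \<phi> (y j)) < e"
      using CauchyD[OF C] by blast
    have "norm (\<phi> (y (m k) - y (n k)) - 0) < e" if "k \<ge> N" for k
      using N[of "m k" "n k"] mn[of k] that by (simp add: linear_diff[OF lin])
    then show "\<exists>no. \<forall>k\<ge>no. norm (\<phi> (y (m k) - y (n k)) - 0) < e" by blast
  qed
qed

lemma linear_image_bounded:
  fixes T :: "'x::{real_vector,topological_space} \<Rightarrow> 'a::{real_vector,topological_space}"
  assumes T: "linear T" "continuous_on UNIV T" and B: "tvs_bounded B"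
  shows "tvs_bounded (T ` B)"
  unfolding tvs_bounded_def
proof (intro allI impI)
  fix U :: "'a set" assume U: "open U \<and> 0 \<in> U"
  then have "open (T -` U)" "0 \<in> T -` U"
    using T by (auto simp: continuous_on_open_vimage linear_0)
  then obtain t where "t > 0" "\<forall>b\<in>B. t *\<^sub>R b \<in> T -` U"
    using B unfolding tvs_bounded_def by blast
  then show "\<exists>t>0. \<forall>b\<in>T ` B. t *\<^sub>R b \<in> U" by (auto simp: linear_scale[OF T(1)])
qed

lemma tvs_bounded_subset: "tvs_bounded B \<Longrightarrow> A \<subseteq> B \<Longrightarrow> tvs_bounded A"
  unfolding tvs_bounded_def by (meson subset_iff)

text \<open>Stated for an arbitrary domain type, this one argument gives (ii) and, applied to the
  unit ball, every operator condition on normed domains.\<close>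

lemma limited_null_imp_seq_precompact_image:
  fixes T :: "'x::{real_vector,topological_space} \<Rightarrow> 'e::{real_vector,topological_space}"
  assumes q: "2 \<le> q" and L: "lcs TYPE('e)" and ros: "rosenthal_property TYPE('e)"
    and null: "\<And>x :: nat \<Rightarrow> 'e. weakly_null x \<Longrightarrow> q_infty_limited q (range x) \<Longrightarrow> x \<longlonglongrightarrow> 0"
    and T: "linear T" "continuous_on UNIV T" "adjoint_q_convergent q T" and B: "tvs_bounded B"
  shows "tvs_seq_precompact (T ` B)"
  unfolding tvs_seq_precompact_def
proof (intro allI impI)
  fix x :: "nat \<Rightarrow> 'e" assume x: "\<forall>n. x n \<in> T ` B"
  have q0: "0 \<le> q" using q by (rule order_trans[rotated]) simp
  have lim: "q_infty_limited q (T ` B)"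
    using x by (intro adjoint_q_convergent_limited_image[OF q0 T(1,3) B]) auto
  have "tvs_bounded (range x)"
    using linear_image_bounded[OF T(1,2) B] by (rule tvs_bounded_subset) (use x in auto)
  then obtain r :: "nat \<Rightarrow> nat" where r: "strict_mono r" "weakly_Cauchy (x \<circ> r) \<or> equiv_ell1_basis (x \<circ> r)"
    using ros unfolding rosenthal_property_def by blast
  define y where "y = x \<circ> r"
  have yA: "y n \<in> T ` B" for n using x by (simp add: y_def)
  have wC: "weakly_Cauchy y"
    using r(2) limited_not_ell1_basis[OF L q lim, of y] yA unfolding y_def by blast
  have "tvs_Cauchy y"
  proof (rule ccontr)
    assume "\<not> tvs_Cauchy y"
    then obtain U where U: "open U" "0 \<in> U" and nU: "\<not> (\<exists>N. \<forall>m\<ge>N. \<forall>n\<ge>N. y m - y n \<in> U)"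
      unfolding tvs_Cauchy_def by auto
    have "\<exists>z. fst z \<ge> k \<and> snd z \<ge> k \<and> y (fst z) - y (snd z) \<notin> U" for k
      using nU by force
    then obtain z where z: "\<And>k. fst (z k) \<ge> k \<and> snd (z k) \<ge> k \<and> y (fst (z k)) - y (snd (z k)) \<notin> U"
      by metis
    define m n where "m k = fst (z k)" and "n k = snd (z k)" for k
    have mn: "\<And>k. m k \<ge> k" "\<And>k. n k \<ge> k" "\<And>k. y (m k) - y (n k) \<notin> U"
      using z by (auto simp: m_def n_def)
    have "(\<lambda>k. y (m k) - y (n k)) \<longlonglongrightarrow> 0"
      using weakly_Cauchy_diff_null[OF wC mn(1,2)]
        q_infty_limited_range_diff[OF lim, of "\<lambda>k. y (m k)" "\<lambda>k. y (n k)"] yA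
      by (intro null) auto
    then have "eventually (\<lambda>k. y (m k) - y (n k) \<in> U) sequentially"
      using U(1,2) by (rule topological_tendstoD)
    then show False using mn(3) by (auto simp: eventually_sequentially)
  qed
  then show "\<exists>r :: nat \<Rightarrow> nat. strict_mono r \<and> tvs_Cauchy (x \<circ> r)" using r(1) y_def by blast
qed

lemma unit_ball_tvs_bounded: "tvs_bounded (ball (0::'y::real_normed_vector) 1)"
  unfolding tvs_bounded_def
proof (intro allI impI)
  fix U :: "'y set" assume "open U \<and> 0 \<in> U"
  then obtain e where e: "e > 0" "ball 0 e \<subseteq> U" using open_contains_ball by blast
  have "e *\<^sub>R b \<in> U" if "b \<in> ball 0 1" for b
    using that e by (intro subsetD[OF e(2)]) auto
  then show "\<exists>t>0. \<forall>b\<in>ball 0 1. t *\<^sub>R b \<in> U" using e(1) by blast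
qed

lemma seq_precompact_opI:
  fixes T :: "'y::real_normed_vector \<Rightarrow> 'e::{real_vector,topological_space}"
  assumes "\<And>B. tvs_bounded B \<Longrightarrow> tvs_seq_precompact (T ` B)"
  shows "tvs_seq_precompact_op T"
  unfolding tvs_seq_precompact_op_def
  using assms[OF unit_ball_tvs_bounded] by (intro exI[of _ "ball 0 1"]) auto

text \<open>If p exceeds k + 1 at x k in A, a functional norming x k and dominated by p, divided by
  k + 1, still exceeds 1 there. At each fixed point these functionals are square summable by the
  convergence of the sum of 1 / (k + 1)^2, contradicting limitedness.\<close>

lemma limited_seminorm_bounded:
  fixes A :: "'a::{real_vector,topological_space} set"
  assumes L: "lcs TYPE('a)" and q: "2 \<le> q" and A: "q_infty_limited q A" and p: "cseminorm p"
  shows "\<exists>C. \<forall>x\<in>A. p x \<le> C"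
proof (rule ccontr)
  assume "\<not> ?thesis"
  then have "\<forall>k. \<exists>x. x \<in> A \<and> p x > real (Suc k)" by (meson not_le)
  from choice[OF this] obtain x where x: "\<And>k. x k \<in> A" "\<And>k. p (x k) > real (Suc k)" by blast
  have "\<forall>k. \<exists>\<phi>. \<phi> \<in> cdual \<and> (\<forall>y. \<bar>\<phi> y\<bar> \<le> p y) \<and> \<phi> (x k) = p (x k)"
    using cdual_norming[OF L p] by blast
  from choice[OF this] obtain \<phi> where \<phi>: "\<And>k. \<phi> k \<in> cdual" "\<And>k y. \<bar>\<phi> k y\<bar> \<le> p y"
    "\<And>k. \<phi> k (x k) = p (x k)" by blast
  define \<psi> where "\<psi> k y = inverse (real (Suc k)) * \<phi> k y" for k y
  have "\<psi> k \<in> cdual" for k unfolding \<psi>_def by (rule cdual_scale[OF \<phi>(1)])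
  moreover have "in_lq q (\<lambda>k. \<psi> k y)" for y
  proof (rule in_lq_if_square_summable[OF q])
    have sm: "summable (\<lambda>k. (p y)\<^sup>2 * inverse ((real (Suc k))\<^sup>2))"
      using inverse_squares_sums by (intro summable_mult) (auto simp: sums_iff inverse_eq_divide add.commute)
    show "summable (\<lambda>k. (\<psi> k y)\<^sup>2)"
    proof (rule summable_comparison_test'[OF sm])
      fix k :: nat
      have "(\<phi> k y)\<^sup>2 \<le> (p y)\<^sup>2" using \<phi>(2)[of k y] by (metis abs_ge_zero power2_abs power_mono)
      then show "norm ((\<psi> k y)\<^sup>2) \<le> (p y)\<^sup>2 * inverse ((real (Suc k))\<^sup>2)"
        by (simp add: \<psi>_def power_mult_distrib power_inverse mult.commute mult_left_mono del: of_nat_Suc)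
    qed
  qed
  ultimately have "wstar_q_summable q \<psi>" by (simp add: wstar_q_summable_def)
  then obtain N where "\<forall>n\<ge>N. \<forall>x\<in>A. \<bar>\<psi> n x\<bar> \<le> 1"
    using A zero_less_one unfolding q_infty_limited_iff by blast
  then have "\<bar>\<psi> N (x N)\<bar> \<le> 1" using x(1) by blast
  moreover have "\<psi> N (x N) > 1" using x(2)[of N] by (simp add: \<psi>_def \<phi>(3) field_simps)
  ultimately show False by simp
qed

section \<open>From precompact operators back to null sequences\<close>

text \<open>Closed seminorm balls are weakly closed: a functional norming y m sees p (y m) as the
  limit of its values at y m - y n, and the Cauchy condition bounds these by e / 2. The functional
  depends on m, the threshold N does not.\<close>

lemma weakly_null_Cauchy_tendsto:
  fixes y :: "nat \<Rightarrow> 'a::{real_vector,topological_space}"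
  assumes L: "lcs TYPE('a)" and w: "weakly_null y" and C: "tvs_Cauchy y"
  shows "y \<longlonglongrightarrow> 0"
  unfolding lcs_tendsto_iff[OF L] diff_zero
proof (intro allI impI LIMSEQ_I)
  fix p :: "'a \<Rightarrow> real" and e :: real assume p: "cseminorm p" and e: "e > 0"
  have "e / 2 > 0" using e by simp
  then obtain N where N: "\<And>m n. m \<ge> N \<Longrightarrow> n \<ge> N \<Longrightarrow> p (y m - y n) < e / 2"
    using C p unfolding lcs_tvs_Cauchy_iff[OF L] by blast
  have "p (y m) \<le> e / 2" if m: "m \<ge> N" for m
  proof -
    obtain \<phi> where \<phi>: "\<phi> \<in> cdual" "\<And>x. \<bar>\<phi> x\<bar> \<le> p x" "\<phi> (y m) = p (y m)"
      using cdual_norming[OF L p] by blast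
    have lin: "linear \<phi>" using \<phi>(1) by (simp add: cdual_def)
    have "(\<lambda>n. \<phi> (y n)) \<longlonglongrightarrow> 0" using w \<phi>(1) by (simp add: weakly_null_def)
    then have "(\<lambda>n. \<phi> (y m) - \<phi> (y n)) \<longlonglongrightarrow> \<phi> (y m) - 0" by (intro tendsto_intros)
    moreover have "\<phi> (y m) - \<phi> (y n) \<le> e / 2" if "n \<ge> N" for n
      using \<phi>(2)[of "y m - y n"] N[OF m that] by (simp add: linear_diff[OF lin])
    ultimately have "\<phi> (y m) - 0 \<le> e / 2" by (intro LIMSEQ_le_const2) blast+
    then show ?thesis using \<phi>(3) by simp
  qed
  then show "\<exists>no. \<forall>n\<ge>no. norm (p (y n) - 0) < e"
    using e cseminorm_nonneg[OF p] by (intro exI[of _ N]) fastforce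
qed

lemma tendsto_if_subsequences:
  fixes x :: "nat \<Rightarrow> 'a::topological_space"
  assumes sub: "\<And>r :: nat \<Rightarrow> nat. strict_mono r \<Longrightarrow> \<exists>s :: nat \<Rightarrow> nat. (\<lambda>n. x (r (s n))) \<longlonglongrightarrow> l"
  shows "x \<longlonglongrightarrow> l"
proof (rule topological_tendstoI)
  fix S :: "'a set" assume S: "open S" "l \<in> S"
  show "eventually (\<lambda>n. x n \<in> S) sequentially"
  proof (rule ccontr)
    assume "\<not> ?thesis"
    then have "infinite {n. x n \<notin> S}"
      by (auto simp: frequently_cofinite cofinite_eq_sequentially[symmetric] eventually_cofinite)
    then obtain r :: "nat \<Rightarrow> nat" where r: "strict_mono r" "\<forall>n. r n \<in> {n. x n \<notin> S}"
      using infinite_enumerate by blast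
    obtain s :: "nat \<Rightarrow> nat" where "(\<lambda>n. x (r (s n))) \<longlonglongrightarrow> l" using sub[OF r(1)] by blast
    then have "eventually (\<lambda>n. x (r (s n)) \<in> S) sequentially" using S by (rule topological_tendstoD)
    then show False using r(2) by (auto simp: eventually_sequentially)
  qed
qed

lemma seq_precompact_op_imp_null:
  fixes T :: "'y::real_normed_vector \<Rightarrow> 'e::{real_vector,topological_space}"
  assumes L: "lcs TYPE('e)" and T: "linear T" "tvs_seq_precompact_op T"
    and u: "\<And>n. norm (u n) \<le> 1" "\<And>n. T (u n) = x n" and w: "weakly_null x"
  shows "x \<longlonglongrightarrow> 0"
proof (rule tendsto_if_subsequences)
  fix r :: "nat \<Rightarrow> nat" assume r: "strict_mono r"
  obtain U where U: "open U" "0 \<in> U" "tvs_seq_precompact (T ` U)"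
    using T(2) unfolding tvs_seq_precompact_op_def by blast
  obtain e where e: "e > 0" "ball 0 e \<subseteq> U" using U(1,2) open_contains_ball by blast
  \<comment> \<open>The u n may have norm exactly 1; half the radius puts their multiples strictly
    inside the ball contained in U.\<close>
  define d where "d = e / 2"
  have d: "d > 0" "d < e" using e by (auto simp: d_def)
  have "d *\<^sub>R u n \<in> U" for n
  proof -
    have "norm (d *\<^sub>R u n) \<le> d" using d u(1) by (simp add: mult_left_le)
    then have "norm (d *\<^sub>R u n) < e" using d(2) by (rule le_less_trans)
    then show ?thesis using e(2) by auto
  qed
  then have "\<forall>n. (\<lambda>n. T (d *\<^sub>R u (r n))) n \<in> T ` U" by blast
  then have "\<exists>s. strict_mono s \<and> tvs_Cauchy ((\<lambda>n. T (d *\<^sub>R u (r n))) \<circ> s)"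
    using U(3)[unfolded tvs_seq_precompact_def, THEN spec, of "\<lambda>n. T (d *\<^sub>R u (r n))"]
    by (rule rev_mp)
  then obtain s :: "nat \<Rightarrow> nat" where s: "strict_mono s" "tvs_Cauchy ((\<lambda>n. T (d *\<^sub>R u (r n))) \<circ> s)"
    by blast
  define y where "y n = d *\<^sub>R x (r (s n))" for n
  have "tvs_Cauchy y" using s(2) by (simp add: y_def[abs_def] o_def linear_scale[OF T(1)] u(2))
  moreover have "weakly_null y" unfolding weakly_null_def
  proof
    fix \<phi> :: "'e \<Rightarrow> real" assume \<phi>: "\<phi> \<in> cdual"
    then have lin: "linear \<phi>" by (simp add: cdual_def)
    have "(\<lambda>n. \<phi> (x n)) \<longlonglongrightarrow> 0" using w \<phi> by (simp add: weakly_null_def)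
    from LIMSEQ_subseq_LIMSEQ[OF this strict_mono_o[OF r s(1)]]
    have "(\<lambda>n. d * \<phi> (x (r (s n)))) \<longlonglongrightarrow> d * 0" by (intro tendsto_intros) (simp add: o_def)
    then show "(\<lambda>n. \<phi> (y n)) \<longlonglongrightarrow> 0" by (simp add: y_def linear_scale[OF lin])
  qed
  ultimately have y: "y \<longlonglongrightarrow> 0" by (intro weakly_null_Cauchy_tendsto[OF L])
  have "(\<lambda>n. x (r (s n))) \<longlonglongrightarrow> 0"
    unfolding lcs_tendsto_iff[OF L] diff_zero
  proof (intro allI impI)
    fix p :: "'e \<Rightarrow> real" assume p: "cseminorm p"
    have "(\<lambda>n. p (y n)) \<longlonglongrightarrow> 0" using y p unfolding lcs_tendsto_iff[OF L] by auto
    then have "(\<lambda>n. inverse d * p (y n)) \<longlonglongrightarrow> inverse d * 0" by (intro tendsto_intros)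
    then show "(\<lambda>n. p (x (r (s n)))) \<longlonglongrightarrow> 0" using d by (simp add: y_def cseminorm_scale[OF p])
  qed
  then show "\<exists>s :: nat \<Rightarrow> nat. (\<lambda>n. x (r (s n))) \<longlonglongrightarrow> 0" by blast
qed

text \<open>This lets a seminorm estimate for an operator be applied to functionals, as needed for
  synthesis maps.\<close>

lemma cdual_abs_cseminorm:
  assumes \<phi>: "\<phi> \<in> cdual"
  shows "cseminorm (\<lambda>x. \<bar>\<phi> x\<bar>)"
proof -
  have lin: "linear \<phi>" and c: "continuous_on UNIV \<phi>" using \<phi> by (auto simp: cdual_def)
  have "open (\<phi> -` ball 0 1)" using c by (simp add: continuous_on_open_vimage)
  moreover have "0 \<in> \<phi> -` ball 0 1" by (simp add: linear_0[OF lin])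
  ultimately show ?thesis unfolding cseminorm_def
    by (auto simp: linear_add[OF lin] linear_scale[OF lin] abs_mult intro!: exI[of _ "\<phi> -` ball 0 1"])
qed

lemma norm_bounded_if_tvs_bounded:
  fixes B :: "'y::real_normed_vector set"
  assumes "tvs_bounded B"
  shows "\<exists>K>0. \<forall>b\<in>B. norm b \<le> K"
proof -
  obtain t where t: "t > 0" "\<forall>b\<in>B. t *\<^sub>R b \<in> ball 0 1"
    using assms[unfolded tvs_bounded_def, rule_format, of "ball 0 1"] by auto
  have "norm b \<le> inverse t" if "b \<in> B" for b using t that by (auto simp: field_simps)
  then show ?thesis using t(1) by (intro exI[of _ "inverse t"]) auto
qed

section \<open>Synthesis maps sending unit vectors to a limited sequence\<close>

text \<open>\<open>bd\<close> is used twice: for continuous seminorms it gives continuity, the range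
  of x being bounded, and for the absolute values of the functionals \<phi> n it transfers their
  uniform smallness from the range of x to images of bounded sets.\<close>

lemma limited_synthesis_operator:
  fixes T :: "'y::real_normed_vector \<Rightarrow> 'e::{real_vector,topological_space}"
  assumes L: "lcs TYPE('e)" and q: "2 \<le> q" and lim: "q_infty_limited q (range x)" and T: "linear T"
    and bd: "\<forall>p C f. cseminorm p \<longrightarrow> (\<forall>n. p (x n) \<le> C) \<longrightarrow> p (T f) \<le> C * norm f"
  shows "continuous_on UNIV T" "adjoint_q_convergent q T"
proof -
  show "continuous_on UNIV T"
  proof (rule lcs_linear_continuous_normed[OF L T])
    fix p :: "'e \<Rightarrow> real" assume p: "cseminorm p"
    then obtain C where "\<And>n. p (x n) \<le> C" using limited_seminorm_bounded[OF L q lim] by blast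
    then show "\<exists>C. \<forall>f. p (T f) \<le> C * norm f" using bd p by blast
  qed
  have q0: "0 \<le> q" using q by (rule order_trans[rotated]) simp
  show "adjoint_q_convergent q T"
    unfolding adjoint_q_convergent_iff[OF q0 T]
  proof (intro allI impI)
    fix \<phi> :: "nat \<Rightarrow> 'e \<Rightarrow> real" and B :: "'y set" and e :: real
    assume \<phi>: "wstar_q_summable q \<phi>" and B: "tvs_bounded B" and e: "e > 0"
    obtain K where K: "K > 0" "\<And>b. b \<in> B \<Longrightarrow> norm b \<le> K" using norm_bounded_if_tvs_bounded[OF B] by blast
    have "e / K > 0" using e K by simp
    then obtain N where N: "\<forall>n\<ge>N. \<forall>z\<in>range x. \<bar>\<phi> n z\<bar> \<le> e / K"
      using lim \<phi> unfolding q_infty_limited_iff by blast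
    have "\<bar>\<phi> n (T b)\<bar> \<le> e" if nb: "n \<ge> N" "b \<in> B" for n b
    proof -
      have "cseminorm (\<lambda>z. \<bar>\<phi> n z\<bar>)" using \<phi> by (intro cdual_abs_cseminorm) (simp add: wstar_q_summable_def)
      then have "\<bar>\<phi> n (T b)\<bar> \<le> e / K * norm b" using bd[rule_format] N nb by fastforce
      also have "\<dots> \<le> e / K * K" using K nb e by (intro mult_left_mono) auto
      finally show ?thesis using K by simp
    qed
    then show "\<exists>N. \<forall>n\<ge>N. \<forall>b\<in>B. \<bar>\<phi> n (T b)\<bar> \<le> e" by blast
  qed
qed

text \<open>The common end of (iv) => (i) and (vi) => (i), which differ only in how the synthesis
  map is built.\<close>

lemma seq_precompact_ops_imp_limited_null:
  fixes x :: "nat \<Rightarrow> 'e::{real_vector,topological_space}" and T :: "'y::real_normed_vector \<Rightarrow> 'e"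
  assumes L: "lcs TYPE('e)" and q: "2 \<le> q" and w: "weakly_null x" and lim: "q_infty_limited q (range x)"
    and pc: "\<And>T :: 'y \<Rightarrow> 'e. linear T \<Longrightarrow> continuous_on UNIV T \<Longrightarrow> adjoint_q_convergent q T \<Longrightarrow> tvs_seq_precompact_op T"
    and T: "linear T"
    and bd: "\<forall>p C f. cseminorm p \<longrightarrow> (\<forall>n. p (x n) \<le> C) \<longrightarrow> p (T f) \<le> C * norm f"
    and u: "\<And>n. norm (u n) \<le> 1" "\<And>n. T (u n) = x n"
  shows "x \<longlonglongrightarrow> 0"
  using limited_synthesis_operator[OF L q lim T bd]
  by (intro seq_precompact_op_imp_null[OF L T pc[OF T] u w]) auto

lemma cseminorm_partial_sum:
  assumes p: "cseminorm p" and C: "\<And>n. p (x n) \<le> C" and F: "finite F"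
  shows "p (\<Sum>n\<in>F. f n *\<^sub>R x n) \<le> C * (\<Sum>n\<in>F. \<bar>f n\<bar>)"
proof -
  have "p (\<Sum>n\<in>F. f n *\<^sub>R x n) \<le> (\<Sum>n\<in>F. p (f n *\<^sub>R x n))" by (rule cseminorm_sum[OF p])
  also have "\<dots> \<le> (\<Sum>n\<in>F. C * \<bar>f n\<bar>)"
    using mult_right_mono[OF C abs_ge_zero] by (intro sum_mono) (simp add: cseminorm_scale[OF p] mult.commute)
  finally show ?thesis by (simp add: sum_distrib_left)
qed

text \<open>Finite supports turn the series into finite sums, so no completeness of the target is
  involved.\<close>

lemma ell1_0_synthesis:
  fixes x :: "nat \<Rightarrow> 'e::{real_vector,topological_space}"
  shows "\<exists>(T :: ell1_0 \<Rightarrow> 'e) u. linear T \<and>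
    (\<forall>p C f. cseminorm p \<longrightarrow> (\<forall>n. p (x n) \<le> C) \<longrightarrow> p (T f) \<le> C * norm f) \<and>
    (\<forall>n. norm (u n) \<le> 1) \<and> (\<forall>n. T (u n) = x n)"
proof -
  define T where "T f = (\<Sum>n\<in>{n. ell1_0_seq f n \<noteq> 0}. ell1_0_seq f n *\<^sub>R x n)" for f
  have fs: "finite {n. ell1_0_seq f n \<noteq> 0}" for f using ell1_0_seq[of f] by simp
  \<comment> \<open>Supports vary with f; summing over any larger finite set lets two elements share
    one index set.\<close>
  have TF: "T f = (\<Sum>n\<in>F. ell1_0_seq f n *\<^sub>R x n)" if "finite F" "{n. ell1_0_seq f n \<noteq> 0} \<subseteq> F" for F f
    unfolding T_def using that by (intro sum.mono_neutral_left) auto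
  have lin: "linear T"
  proof (rule linearI)
    fix f g
    let ?F = "{n. ell1_0_seq f n \<noteq> 0} \<union> {n. ell1_0_seq g n \<noteq> 0}"
    have F: "finite ?F" using fs by simp
    show "T (f + g) = T f + T g"
      using TF[OF F, of "f + g"] TF[OF F, of f] TF[OF F, of g]
      by (auto simp: plus_ell1_0.rep_eq scaleR_add_left sum.distrib subset_iff)
  next
    fix c f
    show "T (c *\<^sub>R f) = c *\<^sub>R T f"
      using TF[OF fs[of f], of "c *\<^sub>R f"] TF[OF fs[of f], of f]
      by (auto simp: scaleR_ell1_0.rep_eq scaleR_sum_right)
  qed
  have bd: "p (T f) \<le> C * norm f" if p: "cseminorm p" and C: "\<And>n. p (x n) \<le> C" for p C f
  proof -
    let ?a = "ell1_0_seq f"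
    have "p (T f) \<le> C * (\<Sum>n\<in>{n. ?a n \<noteq> 0}. \<bar>?a n\<bar>)"
      unfolding T_def by (rule cseminorm_partial_sum[OF p C fs])
    also have "(\<Sum>n\<in>{n. ?a n \<noteq> 0}. \<bar>?a n\<bar>) = (\<Sum>n. \<bar>?a n\<bar>)"
      by (rule suminf_finite[symmetric]) (use fs in auto)
    also have "\<dots> = norm f" by (simp add: norm_ell1_0.rep_eq l1n_def)
    finally show ?thesis .
  qed
  define u where "u n = Abs_ell1_0 (\<lambda>k. if k = n then 1 else 0)" for n
  have us: "ell1_0_seq (u n) = (\<lambda>k. if k = n then 1 else 0)" for n
    unfolding u_def by (rule Abs_ell1_0_inverse) simp
  have "norm (u n) \<le> 1" for n
  proof -
    have "(\<Sum>k. \<bar>ell1_0_seq (u n) k\<bar>) = (\<Sum>k\<in>{n}. \<bar>ell1_0_seq (u n) k\<bar>)"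
      by (rule suminf_finite) (auto simp: us)
    then show ?thesis by (simp add: norm_ell1_0.rep_eq l1n_def us)
  qed
  moreover have "T (u n) = x n" for n
    using TF[of "{n}" "u n"] by (simp add: us)
  ultimately show ?thesis using lin bd by (intro exI[of _ T] exI[of _ u]) blast
qed

section \<open>Absolutely convergent series in locally complete spaces\<close>

text \<open>With \<open>t n\<close> the tails of \<open>\<Sum>\<bar>f n\<bar>\<close>, take \<open>h n = sqrt (t n)\<close>: then
  \<open>\<bar>f n\<bar> / h n \<le> 2 (h n - h (Suc n))\<close> telescopes.\<close>

lemma summable_factor_null:
  fixes f :: "nat \<Rightarrow> real"
  assumes f: "summable (\<lambda>n. \<bar>f n\<bar>)"
  shows "\<exists>g h G. (\<forall>n. f n = g n * h n) \<and> h \<longlonglongrightarrow> 0 \<and> (\<forall>N. (\<Sum>n<N. \<bar>g n\<bar>) \<le> G)"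
proof -
  define t where "t n = (\<Sum>k. \<bar>f k\<bar>) - (\<Sum>k<n. \<bar>f k\<bar>)" for n
  define h where "h n = sqrt (t n)" for n
  define g where "g n = f n / h n" for n
  have t0: "t n \<ge> 0" for n unfolding t_def using sum_le_suminf[OF f, of "{..<n}"] by simp
  have tS: "t n - t (Suc n) = \<bar>f n\<bar>" for n by (simp add: t_def)
  have "t \<longlonglongrightarrow> (\<Sum>k. \<bar>f k\<bar>) - (\<Sum>k. \<bar>f k\<bar>)"
    unfolding t_def by (intro tendsto_intros summable_LIMSEQ[OF f])
  then have tl: "t \<longlonglongrightarrow> 0" by simp
  have hl: "h \<longlonglongrightarrow> 0" unfolding h_def using tendsto_real_sqrt[OF tl] by simp
  have h0: "h n \<ge> 0" for n by (simp add: h_def t0)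
  have hd: "h (Suc n) \<le> h n" for n unfolding h_def using tS[of n] by simp
  \<comment> \<open>Where the tail vanishes so does f n, hence division by zero, with value 0, still
    gives the factorisation.\<close>
  have hz: "f n = 0" if "h n = 0" for n using that tS[of n] t0[of "Suc n"] by (simp add: h_def)
  have fe: "f n = g n * h n" for n using hz[of n] by (simp add: g_def)
  have gb: "\<bar>g n\<bar> \<le> 2 * (h n - h (Suc n))" for n
  proof (cases "h n = 0")
    case True
    then show ?thesis using hd[of n] h0[of "Suc n"] by (simp add: g_def)
  next
    case False
    then have hp: "h n > 0" using h0[of n] by simp
    have "\<bar>f n\<bar> = (h n)\<^sup>2 - (h (Suc n))\<^sup>2" using tS[of n] by (simp add: h_def t0)
    also have "\<dots> = (h n - h (Suc n)) * (h n + h (Suc n))" by (simp add: power2_eq_square algebra_simps)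
    also have "\<dots> \<le> (h n - h (Suc n)) * (2 * h n)" using hd[of n] by (intro mult_left_mono) auto
    finally have "\<bar>f n\<bar> \<le> 2 * (h n - h (Suc n)) * h n" by (simp add: algebra_simps)
    then show ?thesis using hp by (simp add: g_def abs_divide pos_divide_le_eq)
  qed
  have "(\<Sum>n<N. \<bar>g n\<bar>) \<le> 2 * h 0" for N
  proof -
    have "(\<Sum>n<N. \<bar>g n\<bar>) \<le> (\<Sum>n<N. 2 * (h n - h (Suc n)))" by (rule sum_mono) (rule gb)
    also have "\<dots> = 2 * (h 0 - h N)" by (simp only: sum_distrib_left[symmetric] sum_lessThan_telescope')
    also have "\<dots> \<le> 2 * h 0" using h0[of N] by simp
    finally show ?thesis .
  qed
  then show ?thesis using fe hl by blast
qed

text \<open>In \<open>abs_convex_hull\<close> the coefficients are indexed by vectors. Coefficients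
  of equal terms y n are therefore merged first, which by the triangle inequality does not increase
  their absolute sum.\<close>

lemma abs_convex_hull_sum:
  fixes y :: "nat \<Rightarrow> 'a::real_vector"
  assumes g: "(\<Sum>n<N. \<bar>g n\<bar>) \<le> 1"
  shows "(\<Sum>n<N. g n *\<^sub>R y n) \<in> abs_convex_hull (range y)"
proof -
  define F where "F = y ` {..<N}"
  define c where "c s = (\<Sum>n\<in>{n\<in>{..<N}. y n = s}. g n)" for s
  have "(\<Sum>n<N. g n *\<^sub>R y n) = (\<Sum>s\<in>F. \<Sum>n\<in>{n\<in>{..<N}. y n = s}. g n *\<^sub>R y n)"
    unfolding F_def by (rule sum.image_gen) simp
  also have "\<dots> = (\<Sum>s\<in>F. c s *\<^sub>R s)"
    unfolding c_def scaleR_sum_left by (intro sum.cong) auto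
  finally have 1: "(\<Sum>n<N. g n *\<^sub>R y n) = (\<Sum>s\<in>F. c s *\<^sub>R s)" .
  have "(\<Sum>s\<in>F. \<bar>c s\<bar>) \<le> (\<Sum>s\<in>F. \<Sum>n\<in>{n\<in>{..<N}. y n = s}. \<bar>g n\<bar>)"
    unfolding c_def by (intro sum_mono sum_abs)
  also have "\<dots> = (\<Sum>n<N. \<bar>g n\<bar>)"
    unfolding F_def by (rule sum.image_gen[symmetric]) simp
  also have "\<dots> \<le> 1" by (rule g)
  finally have "(\<Sum>s\<in>F. \<bar>c s\<bar>) \<le> 1" .
  then show ?thesis unfolding abs_convex_hull_def using 1
    by (intro CollectI exI[of _ F] exI[of _ c]) (auto simp: F_def)
qed

lemma cseminorm_closed_ball:
  fixes p :: "'a::{real_vector,topological_space} \<Rightarrow> real"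
  assumes L: "lcs TYPE('a)" and p: "cseminorm p"
  shows "closed {z. p (c - z) \<le> e}"
  unfolding closed_def
proof (subst open_subopen, intro ballI)
  fix z assume z: "z \<in> - {z. p (c - z) \<le> e}"
  then have "p (c - z) - e > 0" by simp
  then obtain V where V: "open V" "z \<in> V" "\<forall>y\<in>V. p (y - z) < p (c - z) - e"
    using cseminorm_nbhd[OF L p] by blast
  have "\<not> p (c - y) \<le> e" if "y \<in> V" for y
  proof -
    have "p ((c - y) + (y - z)) \<le> p (c - y) + p (y - z)" by (rule cseminorm_add[OF p])
    then show ?thesis using V(3) that by force
  qed
  then show "\<exists>T. open T \<and> z \<in> T \<and> T \<subseteq> - {z. p (c - z) \<le> e}" using V by blast
qed

text \<open>A cluster point of a Cauchy sequence is its limit: the closed seminorm ball around s m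
  contains a tail, hence also the cluster point.\<close>

lemma compact_Cauchy_converges:
  fixes s :: "nat \<Rightarrow> 'a::{real_vector,topological_space}"
  assumes L: "lcs TYPE('a)" and K: "compact K" "\<And>n. s n \<in> K" and C: "tvs_Cauchy s"
  shows "\<exists>l. s \<longlonglongrightarrow> l"
proof -
  obtain l where l: "\<And>C. closed C \<Longrightarrow> eventually (\<lambda>n. s n \<in> C) sequentially \<Longrightarrow> l \<in> C"
    using compact_sequence_cluster[of K s] K by blast
  have "s \<longlonglongrightarrow> l"
    unfolding lcs_tendsto_iff[OF L]
  proof (intro allI impI LIMSEQ_I)
    fix p :: "'a \<Rightarrow> real" and e :: real assume p: "cseminorm p" and e: "e > 0"
    have "e / 2 > 0" using e by simp
    then obtain N where N: "\<And>m n. m \<ge> N \<Longrightarrow> n \<ge> N \<Longrightarrow> p (s m - s n) < e / 2"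
      using C p unfolding lcs_tvs_Cauchy_iff[OF L] by blast
    have "p (s m - l) \<le> e / 2" if m: "m \<ge> N" for m
    proof -
      have "l \<in> {z. p (s m - z) \<le> e / 2}"
        using N[OF m] by (intro l cseminorm_closed_ball[OF L p])
          (auto simp: eventually_sequentially intro!: exI[of _ N] less_imp_le)
      then show ?thesis by simp
    qed
    then show "\<exists>no. \<forall>n\<ge>no. norm (p (s n - l) - 0) < e"
      using e cseminorm_nonneg[OF p] by (intro exI[of _ N]) fastforce
  qed
  then show ?thesis by blast
qed

lemma partial_sums_Cauchy:
  fixes x :: "nat \<Rightarrow> 'a::{real_vector,topological_space}"
  assumes L: "lcs TYPE('a)" and bd: "\<forall>p. cseminorm p \<longrightarrow> (\<exists>C. \<forall>n. p (x n) \<le> C)"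
    and f: "summable (\<lambda>n. \<bar>f n\<bar>)"
  shows "tvs_Cauchy (\<lambda>N. \<Sum>n<N. f n *\<^sub>R x n)"
  unfolding lcs_tvs_Cauchy_iff[OF L]
proof (intro allI impI)
  fix p :: "'a \<Rightarrow> real" and e :: real assume p: "cseminorm p" and e: "e > 0"
  obtain C where C: "\<And>n. p (x n) \<le> C" using bd p by blast
  have C0: "C \<ge> 0" using C[of 0] cseminorm_nonneg[OF p, of "x 0"] by simp
  define s where "s N = (\<Sum>n<N. f n *\<^sub>R x n)" for N
  define a where "a N = (\<Sum>n<N. \<bar>f n\<bar>)" for N
  have le: "p (s m - s n) \<le> C * \<bar>a m - a n\<bar>" for m n
  proof -
    have *: "p (s m - s n) \<le> C * \<bar>a m - a n\<bar>" if "n \<le> m" for m n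
    proof -
      have S: "{..<m} - {..<n} = {n..<m}" by auto
      have "s m - s n = (\<Sum>k\<in>{n..<m}. f k *\<^sub>R x k)"
        unfolding s_def using that by (subst sum_diff[symmetric]) (auto simp: S)
      moreover have "a m - a n = (\<Sum>k\<in>{n..<m}. \<bar>f k\<bar>)"
        unfolding a_def using that by (subst sum_diff[symmetric]) (auto simp: S)
      ultimately show ?thesis using cseminorm_partial_sum[OF p C, of "{n..<m}" f] by (simp add: sum_nonneg)
    qed
    show ?thesis
    proof (cases "n \<le> m")
      case False
      have "p (s m - s n) = p (s n - s m)" using cseminorm_minus[OF p, of "s n - s m"] by simp
      then show ?thesis using *[of m n] False by (simp add: abs_minus_commute)
    qed (rule *)
  qed
  have "Cauchy a" using f unfolding a_def summable_iff_convergent by (simp add: convergent_Cauchy)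
  \<comment> \<open>C may be 0, and C + 1 keeps the quotient meaningful.\<close>
  moreover have "e / (C + 1) > 0" using e C0 by simp
  ultimately obtain N where N: "\<And>m n. m \<ge> N \<Longrightarrow> n \<ge> N \<Longrightarrow> norm (a m - a n) < e / (C + 1)"
    using CauchyD by blast
  have "p (s m - s n) < e" if mn: "m \<ge> N" "n \<ge> N" for m n
  proof -
    have "p (s m - s n) \<le> (C + 1) * \<bar>a m - a n\<bar>"
      by (rule order_trans[OF le]) (intro mult_right_mono, auto)
    also have "\<dots> < e" using N[OF mn] C0 by (simp add: field_simps)
    finally show ?thesis .
  qed
  then show "\<exists>N. \<forall>m\<ge>N. \<forall>n\<ge>N. p ((\<Sum>n<m. f n *\<^sub>R x n) - (\<Sum>i<n. f i *\<^sub>R x i)) < e"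
    unfolding s_def by blast
qed

text \<open>The null factor of the coefficients is moved onto the bounded vectors. The rescaled
  vectors form a null sequence, and the partial sums become absolutely convex combinations of it, so
  they stay in a compact set.\<close>

lemma locally_complete_series_converges:
  fixes x :: "nat \<Rightarrow> 'a::{real_vector,topological_space}"
  assumes L: "lcs TYPE('a)" and lc: "locally_complete TYPE('a)"
    and bd: "\<forall>p. cseminorm p \<longrightarrow> (\<exists>C. \<forall>n. p (x n) \<le> C)"
    and f: "summable (\<lambda>n. \<bar>f n\<bar>)"
  shows "\<exists>l. (\<lambda>N. \<Sum>n<N. f n *\<^sub>R x n) \<longlonglongrightarrow> l"
proof -
  obtain g h G where g: "\<And>n. f n = g n * h n" "h \<longlonglongrightarrow> 0" "\<And>N. (\<Sum>n<N. \<bar>g n\<bar>) \<le> G"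
    using summable_factor_null[OF f] by blast
  \<comment> \<open>M is positive and at least G: dividing the coefficients g n by M brings their
    absolute sum below 1, and the vectors are multiplied by M in return.\<close>
  define M where "M = G + 1"
  have M: "M > 0" using g(3)[of 0] by (simp add: M_def)
  define y where "y n = (M * h n) *\<^sub>R x n" for n
  have "y \<longlonglongrightarrow> 0"
    unfolding lcs_tendsto_iff[OF L] diff_zero
  proof (intro allI impI)
    fix p :: "'a \<Rightarrow> real" assume p: "cseminorm p"
    obtain C where C: "\<And>n. p (x n) \<le> C" using bd p by blast
    have "(\<lambda>n. \<bar>M * h n\<bar> * C) \<longlonglongrightarrow> \<bar>M * 0\<bar> * C" by (intro tendsto_intros g(2))
    then have lim: "(\<lambda>n. \<bar>M * h n\<bar> * C) \<longlonglongrightarrow> 0" by simp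
    have "norm (p (y n)) \<le> \<bar>M * h n\<bar> * C" for n
      using cseminorm_nonneg[OF p, of "x n"] C[of n]
      by (simp add: y_def cseminorm_scale[OF p] abs_mult mult_left_mono)
    then show "(\<lambda>n. p (y n)) \<longlonglongrightarrow> 0" by (intro Lim_null_comparison[OF always_eventually lim]) blast
  qed
  then have K: "compact (closure (abs_convex_hull (range y)))" using lc by (simp add: locally_complete_def)
  have eq: "(\<Sum>n<N. f n *\<^sub>R x n) = (\<Sum>n<N. (g n / M) *\<^sub>R y n)" for N
    using M by (simp add: y_def g(1))
  have "(\<Sum>n<N. \<bar>g n / M\<bar>) \<le> 1" for N
    using g(3)[of N] M by (simp add: abs_divide sum_divide_distrib[symmetric] M_def)
  then have "(\<Sum>n<N. f n *\<^sub>R x n) \<in> closure (abs_convex_hull (range y))" for N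
    unfolding eq using closure_subset by (intro subsetD[OF closure_subset] abs_convex_hull_sum)
  then show ?thesis using compact_Cauchy_converges[OF L K _ partial_sums_Cauchy[OF L bd f]] by blast
qed

section \<open>Limit laws and the synthesis map on l_1\<close>

text \<open>Separation is part of \<open>lcs\<close> and not of the type, so limits are compared
  through seminorms.\<close>

lemma lcs_limit_unique:
  fixes s :: "nat \<Rightarrow> 'a::{real_vector,topological_space}"
  assumes L: "lcs TYPE('a)" and l: "s \<longlonglongrightarrow> l" and m: "s \<longlonglongrightarrow> m"
  shows "l = m"
proof -
  have "p (l - m) = 0" if p: "cseminorm p" for p
  proof -
    have "(\<lambda>n. p (s n - m) + p (s n - l)) \<longlonglongrightarrow> 0 + 0"
      using l m p unfolding lcs_tendsto_iff[OF L] by (intro tendsto_add) auto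
    moreover have "p (l - m) \<le> p (s n - m) + p (s n - l)" for n
      using cseminorm_diff[OF p, of "s n - m" "s n - l"] by simp
    ultimately have "p (l - m) \<le> 0" using LIMSEQ_le_const[of _ "0 + 0 :: real" "p (l - m)"] by auto
    then show ?thesis using cseminorm_nonneg[OF p, of "l - m"] by simp
  qed
  then have "l - m = 0" by (rule lcs_separated[OF L])
  then show ?thesis by simp
qed

lemma lcs_tendsto_add:
  fixes s :: "nat \<Rightarrow> 'a::{real_vector,topological_space}"
  assumes L: "lcs TYPE('a)" and s: "s \<longlonglongrightarrow> l" and t: "t \<longlonglongrightarrow> m"
  shows "(\<lambda>n. s n + t n) \<longlonglongrightarrow> l + m"
  unfolding lcs_tendsto_iff[OF L]
proof (intro allI impI)
  fix p :: "'a \<Rightarrow> real" assume p: "cseminorm p"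
  have "(\<lambda>n. p (s n - l) + p (t n - m)) \<longlonglongrightarrow> 0 + 0"
    using s t p unfolding lcs_tendsto_iff[OF L] by (intro tendsto_add) auto
  then have lim: "(\<lambda>n. p (s n - l) + p (t n - m)) \<longlonglongrightarrow> 0" by simp
  have "norm (p (s n + t n - (l + m))) \<le> p (s n - l) + p (t n - m)" for n
    using cseminorm_add[OF p, of "s n - l" "t n - m"] cseminorm_nonneg[OF p, of "s n + t n - (l + m)"]
    by (simp add: algebra_simps)
  then show "(\<lambda>n. p (s n + t n - (l + m))) \<longlonglongrightarrow> 0"
    by (intro Lim_null_comparison[OF always_eventually lim]) blast
qed

lemma lcs_tendsto_scale:
  fixes s :: "nat \<Rightarrow> 'a::{real_vector,topological_space}"
  assumes L: "lcs TYPE('a)" and s: "s \<longlonglongrightarrow> l"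
  shows "(\<lambda>n. c *\<^sub>R s n) \<longlonglongrightarrow> c *\<^sub>R l"
  unfolding lcs_tendsto_iff[OF L] scaleR_diff_right[symmetric]
proof (intro allI impI)
  fix p :: "'a \<Rightarrow> real" assume p: "cseminorm p"
  have "(\<lambda>n. \<bar>c\<bar> * p (s n - l)) \<longlonglongrightarrow> \<bar>c\<bar> * 0"
    using s p unfolding lcs_tendsto_iff[OF L] by (intro tendsto_mult tendsto_const) auto
  then show "(\<lambda>n. p (c *\<^sub>R (s n - l))) \<longlonglongrightarrow> 0" by (simp add: cseminorm_scale[OF p])
qed

lemma ell1_synthesis:
  fixes x :: "nat \<Rightarrow> 'e::{real_vector,topological_space}"
  assumes L: "lcs TYPE('e)" and lc: "locally_complete TYPE('e)"
    and bd: "\<forall>p. cseminorm p \<longrightarrow> (\<exists>C. \<forall>n. p (x n) \<le> C)"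
  shows "\<exists>(T :: ell1 \<Rightarrow> 'e) u. linear T \<and>
    (\<forall>p C f. cseminorm p \<longrightarrow> (\<forall>n. p (x n) \<le> C) \<longrightarrow> p (T f) \<le> C * norm f) \<and>
    (\<forall>n. norm (u n) \<le> 1) \<and> (\<forall>n. T (u n) = x n)"
proof -
  define s where "s f N = (\<Sum>n<N. ell1_seq f n *\<^sub>R x n)" for f N
  have "\<forall>f. \<exists>l. s f \<longlonglongrightarrow> l"
    unfolding s_def by (intro allI locally_complete_series_converges[OF L lc bd ell1_summable])
  from choice[OF this] obtain T where T: "\<And>f. s f \<longlonglongrightarrow> T f" by blast
  have "linear T"
  proof (rule linearI)
    fix f g
    have "s (f + g) = (\<lambda>N. s f N + s g N)"
      by (simp add: fun_eq_iff s_def plus_ell1.rep_eq scaleR_add_left sum.distrib)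
    then show "T (f + g) = T f + T g"
      using lcs_limit_unique[OF L T[of "f + g"]] lcs_tendsto_add[OF L T[of f] T[of g]] by simp
  next
    fix c f
    have "s (c *\<^sub>R f) = (\<lambda>N. c *\<^sub>R s f N)"
      by (simp add: fun_eq_iff s_def scaleR_ell1.rep_eq scaleR_sum_right)
    then show "T (c *\<^sub>R f) = c *\<^sub>R T f"
      using lcs_limit_unique[OF L T[of "c *\<^sub>R f"]] lcs_tendsto_scale[OF L T[of f], of c] by simp
  qed
  moreover have "p (T f) \<le> C * norm f" if p: "cseminorm p" and C: "\<And>n. p (x n) \<le> C" for p C f
  proof -
    have C0: "C \<ge> 0" using C[of 0] cseminorm_nonneg[OF p, of "x 0"] by simp
    \<comment> \<open>The bound for partial sums passes to the limit with a correction term that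
      tends to zero.\<close>
    have "(\<lambda>N. C * norm f + p (s f N - T f)) \<longlonglongrightarrow> C * norm f + 0"
      using T[of f] p unfolding lcs_tendsto_iff[OF L] by (intro tendsto_add tendsto_const) auto
    moreover have "p (T f) \<le> C * norm f + p (s f N - T f)" for N
    proof -
      have "p (s f N) \<le> C * (\<Sum>n<N. \<bar>ell1_seq f n\<bar>)"
        unfolding s_def by (rule cseminorm_partial_sum[OF p C]) simp
      also have "\<dots> \<le> C * norm f"
        using l1_partial_le[OF ell1_summable, of f N] C0
        by (intro mult_left_mono) (auto simp: norm_ell1_eq l1n_def)
      finally show ?thesis using cseminorm_diff[OF p, of "s f N" "s f N - T f"] by simp
    qed
    ultimately show ?thesis using LIMSEQ_le_const[of _ "C * norm f + 0" "p (T f)"] by auto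
  qed
  moreover have "norm (ell1_unit n) \<le> 1" for n
  proof -
    have "(\<Sum>k. \<bar>ell1_seq (ell1_unit n) k\<bar>) = (\<Sum>k\<in>{n}. \<bar>ell1_seq (ell1_unit n) k\<bar>)"
      by (rule suminf_finite) (auto simp: ell1_unit.rep_eq)
    then show ?thesis by (simp add: norm_ell1_eq ell1_unit.rep_eq)
  qed
  moreover have "T (ell1_unit n) = x n" for n
  proof (rule lcs_limit_unique[OF L T])
    have "s (ell1_unit n) N = x n" if "N \<ge> Suc n" for N
    proof -
      have "s (ell1_unit n) N = (\<Sum>k<N. if k = n then x k else 0)"
        unfolding s_def ell1_unit.rep_eq by (rule sum.cong) auto
      then show ?thesis using that by simp
    qed
    then have "eventually (\<lambda>N. s (ell1_unit n) N = x n) sequentially"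
      by (auto simp: eventually_sequentially)
    then show "s (ell1_unit n) \<longlonglongrightarrow> x n" by (rule tendsto_eventually)
  qed
  ultimately show ?thesis by (intro exI[of _ T] exI[of _ ell1_unit]) blast
qed

text \<open>The type variables 'x, 'y and 'z range over the spaces in (ii), (iii) and (v). Thus
  (iii) => (iv) and (v) => (vi) are the instances 'y = \<open>ell1_0\<close> and 'z =
  \<open>ell1\<close>, and the circles close through the equivalences of (i) with the conditions on
  these two concrete spaces.\<close>

theorem theoremt:
  fixes q :: ereal
  assumes q: "2 \<le> q"
    and E_lcs: "lcs TYPE('e::{real_vector,topological_space})"
    and E_ros: "rosenthal_property TYPE('e)"
  shows
    "((\<forall>x :: nat \<Rightarrow> 'e. weakly_null x \<and> q_infty_limited q (range x) \<longrightarrow> x \<longlonglongrightarrow> 0)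
       \<longleftrightarrow>
      (\<forall>T :: ell1_0 \<Rightarrow> 'e. linear T \<and> continuous_on UNIV T \<and> adjoint_q_convergent q T
          \<longrightarrow> tvs_seq_precompact_op T))
   \<and>
    (lcs TYPE('x::{real_vector,topological_space}) \<longrightarrow>
      (\<forall>x :: nat \<Rightarrow> 'e. weakly_null x \<and> q_infty_limited q (range x) \<longrightarrow> x \<longlonglongrightarrow> 0)
      \<longrightarrow>
      (\<forall>T :: 'x \<Rightarrow> 'e. linear T \<and> continuous_on UNIV T \<and> adjoint_q_convergent q T
          \<longrightarrow> (\<forall>B. tvs_bounded B \<longrightarrow> tvs_seq_precompact (T ` B))))
   \<and>
    ((\<forall>T :: 'y::real_normed_vector \<Rightarrow> 'e. linear T \<and> continuous_on UNIV T \<and> adjoint_q_convergent q T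
          \<longrightarrow> (\<forall>B. tvs_bounded B \<longrightarrow> tvs_seq_precompact (T ` B)))
      \<longrightarrow>
     (\<forall>T :: 'y \<Rightarrow> 'e. linear T \<and> continuous_on UNIV T \<and> adjoint_q_convergent q T
          \<longrightarrow> tvs_seq_precompact_op T))
   \<and>
    ((\<forall>x :: nat \<Rightarrow> 'e. weakly_null x \<and> q_infty_limited q (range x) \<longrightarrow> x \<longlonglongrightarrow> 0)
      \<longrightarrow>
     (\<forall>T :: 'y \<Rightarrow> 'e. linear T \<and> continuous_on UNIV T \<and> adjoint_q_convergent q T
          \<longrightarrow> tvs_seq_precompact_op T))
   \<and>
    (locally_complete TYPE('e) \<longrightarrow>
      ((\<forall>x :: nat \<Rightarrow> 'e. weakly_null x \<and> q_infty_limited q (range x) \<longrightarrow> x \<longlonglongrightarrow> 0)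
         \<longleftrightarrow>
        (\<forall>T :: ell1 \<Rightarrow> 'e. linear T \<and> continuous_on UNIV T \<and> adjoint_q_convergent q T
            \<longrightarrow> tvs_seq_precompact_op T))
      \<and>
      ((\<forall>x :: nat \<Rightarrow> 'e. weakly_null x \<and> q_infty_limited q (range x) \<longrightarrow> x \<longlonglongrightarrow> 0)
        \<longrightarrow>
       (\<forall>T :: 'z::banach \<Rightarrow> 'e. linear T \<and> continuous_on UNIV T \<and> adjoint_q_convergent q T
            \<longrightarrow> tvs_seq_precompact_op T)))"
proof -
  note pc = limited_null_imp_seq_precompact_image[OF q E_lcs E_ros]
  let ?null = "\<forall>x :: nat \<Rightarrow> 'e. weakly_null x \<and> q_infty_limited q (range x) \<longrightarrow> x \<longlonglongrightarrow> 0"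
  have op0: "tvs_seq_precompact_op T"
    if "?null" "linear T" "continuous_on UNIV T" "adjoint_q_convergent q T" for T :: "ell1_0 \<Rightarrow> 'e"
    using that by (intro seq_precompact_opI pc) auto
  have op1: "tvs_seq_precompact_op T"
    if "?null" "linear T" "continuous_on UNIV T" "adjoint_q_convergent q T" for T :: "ell1 \<Rightarrow> 'e"
    using that by (intro seq_precompact_opI pc) auto
  have opy: "tvs_seq_precompact_op T"
    if "?null" "linear T" "continuous_on UNIV T" "adjoint_q_convergent q T" for T :: "'y \<Rightarrow> 'e"
    using that by (intro seq_precompact_opI pc) auto
  have opz: "tvs_seq_precompact_op T"
    if "?null" "linear T" "continuous_on UNIV T" "adjoint_q_convergent q T" for T :: "'z \<Rightarrow> 'e"
    using that by (intro seq_precompact_opI pc) auto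
  have imx: "tvs_seq_precompact (T ` B)"
    if "?null" "linear T" "continuous_on UNIV T" "adjoint_q_convergent q T" "tvs_bounded B"
    for T :: "'x \<Rightarrow> 'e" and B
    using that by (intro pc) auto
  have conv0: "x \<longlonglongrightarrow> 0"
    if H: "\<forall>T :: ell1_0 \<Rightarrow> 'e. linear T \<and> continuous_on UNIV T \<and> adjoint_q_convergent q T
          \<longrightarrow> tvs_seq_precompact_op T"
      and w: "weakly_null x" and lim: "q_infty_limited q (range x)" for x :: "nat \<Rightarrow> 'e"
  proof -
    obtain T :: "ell1_0 \<Rightarrow> 'e" and u where T: "linear T"
      "\<forall>p C f. cseminorm p \<longrightarrow> (\<forall>n. p (x n) \<le> C) \<longrightarrow> p (T f) \<le> C * norm f"
      "\<And>n. norm (u n) \<le> 1" "\<And>n. T (u n) = x n"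
      using ell1_0_synthesis[of x] by blast
    show ?thesis
      by (rule seq_precompact_ops_imp_limited_null[OF E_lcs q w lim _ T]) (use H in blast)
  qed
  have conv1: "x \<longlonglongrightarrow> 0"
    if lc: "locally_complete TYPE('e)"
      and H: "\<forall>T :: ell1 \<Rightarrow> 'e. linear T \<and> continuous_on UNIV T \<and> adjoint_q_convergent q T
          \<longrightarrow> tvs_seq_precompact_op T"
      and w: "weakly_null x" and lim: "q_infty_limited q (range x)" for x :: "nat \<Rightarrow> 'e"
  proof -
    have bd: "\<forall>p. cseminorm p \<longrightarrow> (\<exists>C. \<forall>n. p (x n) \<le> C)"
      using limited_seminorm_bounded[OF E_lcs q lim] by blast
    obtain T :: "ell1 \<Rightarrow> 'e" and u where T: "linear T"
      "\<forall>p C f. cseminorm p \<longrightarrow> (\<forall>n. p (x n) \<le> C) \<longrightarrow> p (T f) \<le> C * norm f"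
      "\<And>n. norm (u n) \<le> 1" "\<And>n. T (u n) = x n"
      using ell1_synthesis[OF E_lcs lc bd] by blast
    show ?thesis
      by (rule seq_precompact_ops_imp_limited_null[OF E_lcs q w lim _ T]) (use H in blast)
  qed
  have imy: "tvs_seq_precompact_op T"
    if "\<forall>T :: 'y \<Rightarrow> 'e. linear T \<and> continuous_on UNIV T \<and> adjoint_q_convergent q T
          \<longrightarrow> (\<forall>B. tvs_bounded B \<longrightarrow> tvs_seq_precompact (T ` B))"
      "linear T \<and> continuous_on UNIV T \<and> adjoint_q_convergent q T" for T :: "'y \<Rightarrow> 'e"
    using that by (intro seq_precompact_opI) blast
  show ?thesis
    apply (intro conjI impI iffI allI)
    subgoal by (rule op0) auto
    subgoal by (rule conv0) auto
    subgoal by (rule imx) auto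
    subgoal by (rule imy) auto
    subgoal by (rule opy) auto
    subgoal by (rule op1) auto
    subgoal by (rule conv1) auto
    subgoal by (rule opz) auto
    done
qed

end
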